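(* Let the system, constraints and notation be as in the context (in particular, the standing assumptions (i)–(v) listed there hold), and assume $\mathbf{E}[\boldsymbol\varphi(\mathbf{G}\mathbf{w})]=0$. Let $x\in\mathbb{R}^{n_x}$ be the observed state, $\rho\in\mathbb{R}_+$ the weight associated with the size of constraint violation, and let $\delta_j\in\mathbb{R}_+$ and $\alpha_j\in[0,1)$, $j=1,\dots,r$, with $\alpha_1+\cdots+\alpha_r=\beta$. Then the stochastic optimal control problem with softened state constraints, (SP) of the context, is a convex second-order cone program with respect to the decision variables $(\mathbf{M},\mathbf{v},\mathbf{Z},\boldsymbol\epsilon)$, and is defined (after dropping from the objective the terms that do not depend on the decision variables) by $$\min_{(\mathbf{M},\mathbf{v},\mathbf{Z},\boldsymbol\epsilon)}\ \mathbf{b}^\top\mathbf{v}+\|\mathbf{v}\|^2_{\mathbf{S}_1}+\nu^\top\mathbf{m}+\|\mathbf{m}\|^2_{\Lambda}+\rho\,\mathbf{1}^\top\boldsymbol\epsilon$$ subject to: $\tilde{x}_0=x$; $\mathbf{M}$ is strictly block lower triangular (as described in the context); $\mathbf{m}=\mathrm{vec}(\mathbf{M})$; $$\mathbf{H}_u\mathbf{v}+\mathbf{Z}^\top\mathbf{k}_w\le\mathbf{k}_u,\qquad \mathbf{Z}^\top\mathbf{H}_w=\mathbf{H}_u\mathbf{M},\qquad \mathbf{Z}\ge 0\ \text{(element-wise)};$$ and, for all $i\in\{1,\dots,N\}$ and $j\in\{1,\dots,r\}$, $$\mathbf{H}^{[i]}_{x,j}\mathbf{A}\tilde{x}_0+\mathbf{H}^{[i]}_{x,j}\mathbf{B}\mathbf{v}\le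 k_{x,j}-\delta_j+\epsilon^m_{i,j},\qquad \mathbf{y}_{i,j}^\top=\mathbf{H}^{[i]}_{x,j}\mathbf{B}\mathbf{M},$$ $$\|\mathbf{y}_{i,j}\|^2_{\Omega_1}+\mathbf{q}_{i,j}^\top\mathbf{y}_{i,j}+c_{i,j}\le\epsilon^v_{i,j},\qquad \epsilon^m_{i,j}\ge0,\qquad \epsilon^v_{i,j}\ge0,$$ where $\boldsymbol\epsilon\in\mathbb{R}^{2rN}$ is the vector of all slack variables $\epsilon^m_{i,j}$ and $\epsilon^v_{i,j}$, $\mathbf{Z}\in\mathbb{R}^{a\times sN}$, $\mathbf{1}$ is the all-ones vector, and $$\mathbf{b}^\top=2\tilde{x}_0^\top\mathbf{A}^\top\mathbf{Q}\mathbf{B},\quad \mathbf{S}_1=\mathbf{B}^\top\mathbf{Q}\mathbf{B}+\mathbf{R},\quad \mathbf{S}_2=2\mathbf{G}^\top\mathbf{D}^\top\mathbf{Q}\mathbf{B},$$ $$\Omega_1=\mathbf{E}[\boldsymbol\varphi(\mathbf{G}\mathbf{w})\boldsymbol\varphi(\mathbf{G}\mathbf{w})^\top],\quad \Omega_2=\mathbf{E}[\boldsymbol\varphi(\mathbf{G}\mathbf{w})\mathbf{w}^\top],\quad \Lambda=\Omega_1\otimes\mathbf{S}_1^\top,\quad \nu=\mathrm{vec}(\mathbf{S}_2^\top\Omega_2^\top),$$ $$\mathbf{q}_{i,j}^\top=2\mathbf{H}^{[i]}_{x,j}\mathbf{D}\mathbf{G}\Omega_2^\top,\quad c_{i,j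}=\mathbf{H}^{[i]}_{x,j}\mathbf{D}\mathbf{G}\Sigma_{\mathbf{w}}\mathbf{G}^\top\mathbf{D}^\top\mathbf{H}^{[i]\top}_{x,j}-\alpha_j\delta_j^2(1-\alpha_j)^{-1}.$$
   Context: Notation: $\|y\|_A^2:=y^\top Ay$; $\mathrm{vec}$ is column-stacking vectorization; $\otimes$ is the Kronecker product; $\mathbb{R}_+$ is the set of nonnegative reals; $\mathbb{S}^n_{+}$, $\mathbb{S}^n_{++}$ are the symmetric positive semidefinite / positive definite $n\times n$ matrices; subscript $j$ on a matrix or vector with row index denotes its $j$th row/entry. A second-order cone program minimizes a linear function subject to linear equalities/inequalities and constraints $\|Fz+f\|_2\le d^\top z+e$; convex quadratically constrained quadratic programs are regarded as a special case (after adding an epigraph variable bounding the quadratic part of the objective). System: $x^+=Ax+Bu+Gw$ with $x\in\mathbb{R}^{n_x}$, $u\in\mathbb{R}^{n_u}$, $w\in\mathbb{R}^{n_w}$. Standing assumptions: (i) $A$ is Schur stable (all eigenvalues strictly inside the unit circle); (ii) states are observed exactly at all times; (iii) the disturbances are i.i.d., zero mean, with known covariance $\Sigma_w\in\mathbb{S}^{n_w}_{++}$ and arbitrary but known density $p_w$ with possibly unbounded support $\Delta_w\subseteq\mathbb{R}^{n_w}$; (iv) hard input constraints $u\in\mathbb{U}=\{u\in\mathbb{R}^{n_u}: H_uu\le k_u\}$, $H_u\in\mathbb{R}^{s\times n_u}$, $k_u\in\mathbb{R}^s$, with $\mathbb{U}$ compact and containing the origin in its interior; (v) joint state chance constraint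 $\mathbf{Pr}[x\in\mathbb{X}]\ge1-\beta$, $\beta\in[0,1)$, $\mathbb{X}=\{x\in\mathbb{R}^{n_x}: H_xx\le k_x\}$ polytopic, $H_x\in\mathbb{R}^{r\times n_x}$, $k_x\in\mathbb{R}^r$. Stacked notation over a horizon $N\in\mathbb{N}$: $\mathbf{w}=[w_0^\top,\dots,w_{N-1}^\top]^\top$ with $w_i$ i.i.d. with density $p_w$, and $\Sigma_{\mathbf{w}}$ is the covariance of $\mathbf{w}$; predicted states $\mathbf{x}=[\tilde{x}_0^\top,\dots,\tilde{x}_N^\top]^\top$ and inputs $\mathbf{u}\in\mathbb{R}^{n_uN}$ satisfy $\mathbf{x}=\mathbf{A}\tilde{x}_0+\mathbf{B}\mathbf{u}+\mathbf{D}\mathbf{G}\mathbf{w}$, where $\mathbf{A}=[I,A^\top,\dots,(A^N)^\top]^\top$; $\mathbf{D}\in\mathbb{R}^{n_x(N+1)\times n_xN}$ has, for $p\in\{0,\dots,N\}$, $q\in\{0,\dots,N-1\}$, $(p,q)$ block equal to $A^{p-1-q}$ if $q\le p-1$ and $0$ otherwise; $\mathbf{B}=\mathbf{D}(I_N\otimes B)$; $\mathbf{G}=I_N\otimes G$. Weights $Q\in\mathbb{S}^{n_x}_+$, $R\in\mathbb{S}^{n_u}_+$; $\mathbf{Q}=\mathrm{diag}(Q,\dots,Q)$ ($N+1$ blocks), $\mathbf{R}=\mathrm{diag}(R,\dots,R)$ ($N$ blocks). $\mathbf{H}_u=\mathrm{diag}(H_u,\dots,H_u)$ ($N$ blocks),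 $\mathbf{k}_u=[k_u^\top,\dots,k_u^\top]^\top$. $\mathbf{H}_x^{[i]}=e_{i+1}^\top\otimes H_x$, where $e_{i+1}$ is the $(i+1)$th standard basis vector of $\mathbb{R}^{N+1}$ (so $\mathbf{H}_x^{[i]}\mathbf{x}=H_x\tilde{x}_i$), with $j$th row $\mathbf{H}^{[i]}_{x,j}$. Control policy: $\mathbf{u}=\mathbf{M}\boldsymbol\varphi(\mathbf{G}\mathbf{w})+\mathbf{v}$, with $\mathbf{v}\in\mathbb{R}^{n_uN}$ and $\mathbf{M}\in\mathbb{R}^{n_uN\times n_xN}$ strictly block lower triangular (an $N\times N$ array of $n_u\times n_x$ blocks $M_{p,q}$ with $M_{p,q}=0$ for $q\ge p$). Here $\boldsymbol\varphi(\mathbf{G}\mathbf{w})$ applies scalar saturation functions $\varphi_i^l:\mathbb{R}\to\mathbb{R}$ componentwise to the entries of $Gw_i$, $i=0,\dots,N-1$, $l=1,\dots,n_x$, with $\sup_{b\in\mathbb{R}}|\varphi_i^l(b)|\le\varphi_{\max}$, so that $\|\boldsymbol\varphi(\mathbf{G}\mathbf{w})\|_\infty\le\varphi_{\max}$ for all $\mathbf{w}\in\Delta_w^N$. These saturated disturbance constraints are expressed by the polytopic set $\mathcal{W}=\{\omega\in\mathbb{R}^{n_xN}:\mathbf{H}_w\omega\le\mathbf{k}_w\}$, with $\mathbf{H}_w\in\mathbb{R}^{a\times n_xN}$, $\mathbf{k}_w\in\mathbb{R}^a$, $a\in\mathbb{N}$ being the number of saturated disturbance constraints; $\boldsymbol\varphi(\mathbf{G}\mathbf{w})\in\mathcal{W}$.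 Under such a policy with $\tilde{x}_0=x$, let $\bar{\mathbf{x}}$ and $\Sigma_{\mathbf{x}}$ be the mean and covariance of $\mathbf{x}$, and let $V_N(x,\mathbf{M},\mathbf{v})=\mathbf{E}[\|\mathbf{x}\|^2_{\mathbf{Q}}+\|\mathbf{u}\|^2_{\mathbf{R}}]$. Softened problem (SP): minimize $V_N(x,\mathbf{M},\mathbf{v})+\rho\|\boldsymbol\epsilon\|_1$, where $\boldsymbol\epsilon\in\mathbb{R}^{2rN}$ collects slack variables $\epsilon^m_{i,j},\epsilon^v_{i,j}\ge0$, subject to: $\mathbf{M}$ strictly block lower triangular; $\tilde{x}_0=x$; $\mathbf{u}=\mathbf{M}\boldsymbol\varphi(\mathbf{G}\mathbf{w})+\mathbf{v}$; the hard input constraint $\mathbf{Pr}[\mathbf{H}_u\mathbf{u}\le\mathbf{k}_u]=1$; and, for all $i\in\{1,\dots,N\}$, $j\in\{1,\dots,r\}$, $$\mathbf{H}^{[i]}_{x,j}\bar{\mathbf{x}}\le k_{x,j}-\delta_j+\epsilon^m_{i,j},\qquad \mathbf{H}^{[i]}_{x,j}\Sigma_{\mathbf{x}}\mathbf{H}^{[i]\top}_{x,j}\le\frac{\alpha_j\delta_j^2}{1-\alpha_j}+\epsilon^v_{i,j}.$$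
   Formalization: Equality of the explicit feasible set with that of (SP) is claimed only when W is the convex hull of the support of the law of φ(Gw); for larger W it can fail, and only inclusion in (SP) and equality with (SP) having the input constraint imposed for all ω in W are stated. *)

theory Defs
  imports "HOL-Probability.Probability"
begin

text \<open>
  Conventions.  An \<open>m \<times> n\<close> matrix has type \<open>real^'n^'m\<close>.  The horizon \<open>N\<close> is \<open>CARD('t)\<close> for a finite
  linearly ordered type \<open>'t\<close> of input and disturbance times; the state times \<open>0, \<dots>, N\<close> are indexed by
  \<open>'t option\<close>.  A vector that stacks blocks over an index type \<open>'p\<close> is indexed by pairs
  (block, position within the block), so that \<open>real^('t \<times> 'n)\<close> stands for \<open>\<real>\<^bsup>nN\<^esup>\<close>.
\<close>

subsection \<open>Matrices\<close>

definition wnorm2 :: "real^'n^'n \<Rightarrow> real^'n \<Rightarrow> real" where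
  "wnorm2 X y = y \<bullet> (X *v y)"

definition pos_semidef :: "real^'n^'n \<Rightarrow> bool" where
  "pos_semidef X \<longleftrightarrow> transpose X = X \<and> (\<forall>y. 0 \<le> y \<bullet> (X *v y))"

definition pos_def :: "real^'n^'n \<Rightarrow> bool" where
  "pos_def X \<longleftrightarrow> transpose X = X \<and> (\<forall>y. y \<noteq> 0 \<longrightarrow> 0 < y \<bullet> (X *v y))"

definition schur_stable :: "real^'n^'n \<Rightarrow> bool" where
  "schur_stable X \<longleftrightarrow>
     (\<forall>e::complex. (\<exists>z. z \<noteq> 0 \<and> (\<chi> i j. complex_of_real (X $ i $ j)) *v z = e *s z) \<longrightarrow> cmod e < 1)"

text \<open>The operator \<open>^\<close> is not usable here: multiplication on the type \<^typ>\<open>real^'n^'n\<close> is entrywise.\<close>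

definition mat_pow :: "real^'n^'n \<Rightarrow> nat \<Rightarrow> real^'n^'n" where
  "mat_pow X k = ((**) X ^^ k) (mat 1)"

definition outer :: "real^'m \<Rightarrow> real^'n \<Rightarrow> real^'n^'m" where
  "outer y z = (\<chi> i j. y $ i * z $ j)"

definition kron :: "real^'b^'a \<Rightarrow> real^'d^'c \<Rightarrow> real^('b \<times> 'd)^('a \<times> 'c)" where
  "kron X Y = (\<chi> i j. X $ fst i $ fst j * Y $ snd i $ snd j)"

definition block_diag :: "real^'n^'m \<Rightarrow> real^('p::finite \<times> 'n)^('p \<times> 'm)" where
  "block_diag X = kron (mat 1) X"

text \<open>Column stacking: the block is the column of the entry, the position in the block is its row.\<close>

definition vectorize :: "real^'n^'m \<Rightarrow> real^('n \<times> 'm)" where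
  "vectorize X = (\<chi> k. X $ snd k $ fst k)"

definition stack :: "('p::finite \<Rightarrow> real^'n) \<Rightarrow> real^('p \<times> 'n)" where
  "stack f = (\<chi> k. f (fst k) $ snd k)"

text \<open>The matrix \<open>e\<^sub>p\<^sup>T \<otimes> H\<close>, with \<open>e\<^sub>p\<close> a standard basis vector.\<close>

definition block_row :: "'p::finite \<Rightarrow> real^'n^'m \<Rightarrow> real^('p \<times> 'n)^'m" where
  "block_row p H = (\<chi> j k. axis p 1 $ fst k * H $ j $ snd k)"

definition strictly_block_lower ::
  "real^('t::{finite,linorder} \<times> 'n::finite)^('t \<times> 'm::finite) \<Rightarrow> bool" where
  "strictly_block_lower M \<longleftrightarrow> (\<forall>p i q j. p \<le> q \<longrightarrow> M $ (p, i) $ (q, j) = 0)"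

subsection \<open>Prediction matrices\<close>

text \<open>The position (counted from \<open>0\<close>) of an input time, and the state time it leads to.  The index
  \<^term>\<open>None\<close> is the initial state, and \<^term>\<open>Some q\<close> is the state reached by the input at time \<open>q\<close>.\<close>

definition step :: "'t::{finite,linorder} \<Rightarrow> nat" where
  "step q = card {q'. q' < q}"

definition state_time :: "'t::{finite,linorder} option \<Rightarrow> nat" where
  "state_time p = (case p of None \<Rightarrow> 0 | Some q \<Rightarrow> Suc (step q))"

definition prediction_A :: "real^'n^'n \<Rightarrow> real^'n^('t::{finite,linorder} option \<times> 'n)" where
  "prediction_A A = (\<chi> k. mat_pow A (state_time (fst k)) $ snd k)"

definition prediction_D ::
  "real^'n^'n \<Rightarrow> real^('t::{finite,linorder} \<times> 'n)^('t option \<times> 'n)" where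
  "prediction_D A =
     (\<chi> k l. if step (fst l) < state_time (fst k)
            then mat_pow A (state_time (fst k) - 1 - step (fst l)) $ snd k $ snd l
            else 0)"

definition saturate :: "('t::finite \<Rightarrow> 'n::finite \<Rightarrow> real \<Rightarrow> real) \<Rightarrow> real^('t \<times> 'n) \<Rightarrow> real^('t \<times> 'n)" where
  "saturate \<phi> y = (\<chi> k. \<phi> (fst k) (snd k) (y $ k))"

subsection \<open>Random vectors\<close>

definition square_integrable :: "'o measure \<Rightarrow> ('o \<Rightarrow> real^'n) \<Rightarrow> bool" where
  "square_integrable P X \<longleftrightarrow>
     X \<in> borel_measurable P \<and> (\<forall>k. integrable P (\<lambda>\<omega>. (X \<omega> $ k)\<^sup>2))"

text \<open>For random vectors that are not square integrable the value is meaningless.\<close>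

definition covariance :: "'o measure \<Rightarrow> ('o \<Rightarrow> real^'n) \<Rightarrow> real^'n^'n" where
  "covariance P X =
     integral\<^sup>L P (\<lambda>\<omega>. outer (X \<omega> - integral\<^sup>L P X) (X \<omega> - integral\<^sup>L P X))"

definition measure_support :: "'b::topological_space measure \<Rightarrow> 'b set" where
  "measure_support \<mu> = {z. \<forall>U. open U \<longrightarrow> z \<in> U \<longrightarrow> 0 < emeasure \<mu> U}"

subsection \<open>Second-order cone programs\<close>

text \<open>A pair \<open>(h, g)\<close> stands for the affine function \<open>z \<mapsto> h \<bullet> z + g\<close>, and a triple \<open>(F, d, e)\<close> for the
  constraint \<open>\<parallel>F z + f\<parallel>\<^sub>2 \<le> d \<bullet> z + e\<close>, where the rows of \<open>F\<close> and the entries of \<open>f\<close> are listed together.\<close>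

record 'z socp =
  cost :: 'z
  equalities :: "('z \<times> real) list"
  inequalities :: "('z \<times> real) list"
  cones :: "(('z \<times> real) list \<times> 'z \<times> real) list"

definition socp_feasible :: "'z::euclidean_space socp \<Rightarrow> 'z set" where
  "socp_feasible C =
     {z. (\<forall>(h, g) \<in> set (equalities C). h \<bullet> z + g = 0) \<and>
         (\<forall>(h, g) \<in> set (inequalities C). h \<bullet> z + g \<le> 0) \<and>
         (\<forall>(F, d, e) \<in> set (cones C). sqrt (\<Sum>(h, g)\<leftarrow>F. (h \<bullet> z + g)\<^sup>2) \<le> d \<bullet> z + e)}"

definition is_socp :: "('z::euclidean_space \<Rightarrow> real) \<Rightarrow> 'z set \<Rightarrow> bool" where
  "is_socp J S \<longleftrightarrow> (\<exists>C. socp_feasible C = S \<and> (\<forall>z. J z = cost C \<bullet> z))"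

text \<open>Minimization of \<open>l + q\<close> over \<open>S\<close>, where \<open>q\<close> is the quadratic part of the objective, as a
  second-order cone program in the decision variable and an epigraph variable \<open>\<tau>\<close> that bounds \<open>q\<close>.\<close>

definition is_epigraph_socp ::
  "('z::euclidean_space \<Rightarrow> real) \<Rightarrow> ('z \<Rightarrow> real) \<Rightarrow> 'z set \<Rightarrow> bool" where
  "is_epigraph_socp l q S \<longleftrightarrow>
     is_socp (\<lambda>(z, \<tau>::real). l z + \<tau>) {(z, \<tau>). z \<in> S \<and> q z \<le> \<tau>}"

end

theory Submission
  imports Defs
begin

text \<open>
  Four observations, independent of each other, make up the proof.

  \<^bold>\<open>Moments.\<close> Under the policy, cost and state are affine in the saturated disturbance \<open>\<phi>(Gw)\<close> and in
  the disturbance \<open>w\<close>, both of mean zero, so only second moments enter the expected cost and the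
  state covariance. Every quadratic expression is a Frobenius inner product,
  \<open>y \<bullet> (K z) = K \<bullet> (y z\<^sup>T)\<close>, and the expectation moves onto the outer product. This produces
  \<open>\<Omega>\<^sub>1\<close>, \<open>\<Omega>\<^sub>2\<close> and the covariance of \<open>w\<close> as coefficients; vectorization is an isometry for the
  Frobenius product and turns \<open>M \<mapsto> S\<^sub>1 M \<Omega>\<^sub>1\<close> into the matrix \<open>\<Lambda>\<close>. See
  \<open>expected_quadratic_cost\<close> and \<open>policy_state_moments\<close>.

  \<^bold>\<open>Duality.\<close> Requiring the input constraint for all points of the polyhedron \<open>\<W>\<close> is a semi-infinite
  constraint. Row by row, the affine Farkas lemma (\<open>farkas_affine\<close>) trades it for a nonnegative
  multiplier; the multipliers are the columns of \<open>Z\<close>. The lemma needs \<open>\<W>\<close> to be nonempty, which holds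
  because the saturated disturbance lies in \<open>\<W>\<close> almost surely.

  \<^bold>\<open>Almost sure against robust.\<close> Since \<open>\<phi>(Gw) \<in> \<W>\<close> almost surely, the robust constraint implies the
  almost sure one. Conversely, an almost sure constraint with a closed set of admissible disturbances
  holds on the support of the law of \<open>\<phi>(Gw)\<close>, and, as this set is convex, on the convex hull of the
  support. Equality of the feasible sets follows when \<open>\<W>\<close> is that hull.

  \<^bold>\<open>Cone representation.\<close> A positive semidefinite quadratic form is a sum of squares of linear forms, and
  \<open>q + f \<le> c\<close> with such a \<open>q\<close> and linear \<open>f\<close> is one second-order cone constraint
  (\<open>socp_representable_quadratic_le\<close>). So the feasible set of the epigraph formulation is the feasible
  set of a cone program. Convexity of the feasible set and of the objective comes with it,
  because the feasible set of a cone program is convex (\<open>socp_representable_epigraph\<close>).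
\<close>

section \<open>Positive semidefinite forms as sums of squares\<close>

definition sum_of_squares :: "('z::euclidean_space \<Rightarrow> real) \<Rightarrow> bool" where
  "sum_of_squares q \<longleftrightarrow> (\<exists>hs. \<forall>z. q z = (\<Sum>h\<leftarrow>hs. (h \<bullet> z)\<^sup>2))"

lemma sum_of_squares_add:
  assumes "sum_of_squares q" and "sum_of_squares q'"
  shows "sum_of_squares (\<lambda>z. q z + q' z)"
proof -
  obtain hs hs' where "q z = (\<Sum>h\<leftarrow>hs. (h \<bullet> z)\<^sup>2)" "q' z = (\<Sum>h\<leftarrow>hs'. (h \<bullet> z)\<^sup>2)" for z
    using assms unfolding sum_of_squares_def by metis
  then have "q z + q' z = (\<Sum>h\<leftarrow>hs @ hs'. (h \<bullet> z)\<^sup>2)" for z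
    by simp
  then show ?thesis
    unfolding sum_of_squares_def by blast
qed

lemma sum_of_squares_linear:
  fixes L :: "'z::euclidean_space \<Rightarrow> 'y::euclidean_space"
  assumes "linear L" and "sum_of_squares q"
  shows "sum_of_squares (\<lambda>z. q (L z))"
proof -
  obtain hs where "q z = (\<Sum>h\<leftarrow>hs. (h \<bullet> z)\<^sup>2)" for z
    using assms unfolding sum_of_squares_def by metis
  then have "q (L z) = (\<Sum>h\<leftarrow>map (adjoint L) hs. (h \<bullet> z)\<^sup>2)" for z
    by (simp add: o_def adjoint_clauses[OF assms(1)])
  then show ?thesis
    unfolding sum_of_squares_def by blast
qed

text \<open>
  For a positive semidefinite form, a null vector of the quadratic form lies in the kernel of the
  operator: otherwise moving from \<open>e\<close> a little in the direction \<open>- T e\<close> would make the form negative.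
\<close>

lemma psd_form_null_imp_kernel:
  fixes T :: "'a::real_inner \<Rightarrow> 'a"
  assumes "linear T" and sym: "\<And>y z. y \<bullet> T z = T y \<bullet> z" and psd: "\<And>y. 0 \<le> y \<bullet> T y"
    and "e \<bullet> T e = 0"
  shows "T e = 0"
proof -
  interpret linear T by fact
  let ?d = "T e"
  have "0 \<le> 2 * s * (?d \<bullet> ?d) + s\<^sup>2 * (?d \<bullet> T ?d)" for s
    using psd[of "e + s *\<^sub>R ?d"] assms(4) sym[of e "?d"]
    by (simp add: add scale inner_simps power2_eq_square algebra_simps)
  \<comment> \<open>near the minimizer \<open>- d / k\<close>; the denominator \<open>k + 1\<close> also covers \<open>k = 0\<close>\<close>
  moreover have "2 * s * d + s\<^sup>2 * k < 0" if "d > 0" "k \<ge> 0" "s = - d / (k + 1)" for s d k :: real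
  proof -
    have "2 * s * d + s\<^sup>2 * k \<le> 2 * s * d + s\<^sup>2 * (k + 1)"
      by (simp add: algebra_simps)
    also have "\<dots> = - (d\<^sup>2 / (k + 1))"
      using that by (simp add: field_simps power2_eq_square)
    also have "\<dots> < 0"
      using that by simp
    finally show ?thesis .
  qed
  ultimately have "\<not> 0 < ?d \<bullet> ?d"
    using psd[of ?d] by (meson not_le)
  then show ?thesis
    by simp
qed

text \<open>
  Symmetric Gaussian elimination: for \<open>a = e \<bullet> T e > 0\<close> and \<open>h = T e / \<surd>a\<close>, subtracting
  the square of \<open>h\<close> leaves a positive semidefinite form that vanishes at \<open>e\<close> and at every vector at
  which the form vanished before. After one pass over an orthonormal basis nothing is left.
\<close>

lemma psd_form_sum_of_squares:
  fixes T :: "'a::euclidean_space \<Rightarrow> 'a"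
  assumes lin: "linear T" and sym: "\<And>y z. y \<bullet> T z = T y \<bullet> z" and psd: "\<And>y. 0 \<le> y \<bullet> T y"
  shows "sum_of_squares (\<lambda>y. y \<bullet> T y)"
proof -
  have peel: "\<exists>hs U. linear U \<and> (\<forall>y z. y \<bullet> U z = U y \<bullet> z) \<and> (\<forall>y. 0 \<le> y \<bullet> U y) \<and>
      (\<forall>e\<in>E. U e = 0) \<and> (\<forall>y. y \<bullet> T y = y \<bullet> U y + (\<Sum>h\<leftarrow>hs. (h \<bullet> y)\<^sup>2))"
    if "finite E" for E
    using that
  proof induction
    case empty
    show ?case
      by (rule exI[of _ "[]"], rule exI[of _ T]) (use assms in auto)
  next
    case (insert e E)
    then obtain hs U where U: "linear U" "\<And>y z. y \<bullet> U z = U y \<bullet> z" "\<And>y. 0 \<le> y \<bullet> U y"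
      "\<And>e. e \<in> E \<Longrightarrow> U e = 0" "\<And>y. y \<bullet> T y = y \<bullet> U y + (\<Sum>h\<leftarrow>hs. (h \<bullet> y)\<^sup>2)"
      by blast
    show ?case
    proof (cases "e \<bullet> U e = 0")
      case True
      then have "U e = 0"
        using psd_form_null_imp_kernel U by blast
      then show ?thesis
        using U by (intro exI[of _ hs] exI[of _ U]) auto
    next
      case False
      define a where "a = e \<bullet> U e"
      have a: "a > 0"
        using False U(3)[of e] unfolding a_def by linarith
      define h where "h = (1 / sqrt a) *\<^sub>R U e"
      define U' where "U' y = U y - (h \<bullet> y) *\<^sub>R h" for y
      interpret U: linear U by fact
      have hh: "(h \<bullet> y) * (h \<bullet> z) = (U e \<bullet> y) * (U e \<bullet> z) / a" for y z
        using a by (simp add: h_def field_simps)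
      have "linear U'"
        unfolding U'_def by (rule linearI) (simp_all add: U.add U.scale inner_simps algebra_simps)
      moreover have "y \<bullet> U' z = U' y \<bullet> z" for y z
        using U(2)[of y z] by (simp add: U'_def inner_simps inner_commute)
      moreover have *: "y \<bullet> U' y = y \<bullet> U y - (h \<bullet> y)\<^sup>2" for y
        by (simp add: U'_def inner_simps inner_commute power2_eq_square)
      moreover have "0 \<le> y \<bullet> U' y" for y
      proof -
        \<comment> \<open>\<open>U'\<close> measures \<open>y\<close> by the minimum of the form \<open>U\<close> on the line through \<open>y\<close> along \<open>e\<close>\<close>
        define s where "s = (U e \<bullet> y) / a"
        have "0 \<le> (y - s *\<^sub>R e) \<bullet> U (y - s *\<^sub>R e)"
          by (rule U(3))
        also have "\<dots> = y \<bullet> U y - 2 * s * (U e \<bullet> y) + s\<^sup>2 * a"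
          using U(2)[of e y] U(2)[of y e]
          by (simp add: U.diff U.scale inner_simps a_def power2_eq_square inner_commute algebra_simps)
        also have "\<dots> = y \<bullet> U y - (U e \<bullet> y)\<^sup>2 / a"
          using a by (simp add: s_def field_simps power2_eq_square)
        also have "\<dots> = y \<bullet> U' y"
          using hh[of y y] by (simp add: * power2_eq_square)
        finally show ?thesis .
      qed
      moreover have "U' f = 0" if "f \<in> insert e E" for f
      proof (cases "f = e")
        case True
        have "U' e = U e - ((U e \<bullet> e) / a) *\<^sub>R U e"
          using a by (simp add: U'_def h_def)
        then show ?thesis
          using a True by (simp add: a_def inner_commute)
      next
        case False
        then have "U f = 0" using that U(4) by blast
        moreover from this have "h \<bullet> f = 0"
          using U(2)[of f e] by (simp add: h_def inner_commute)
        ultimately show ?thesis by (simp add: U'_def)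
      qed
      moreover have "y \<bullet> T y = y \<bullet> U' y + (\<Sum>h\<leftarrow>h # hs. (h \<bullet> y)\<^sup>2)" for y
        using U(5)[of y] * by simp
      ultimately show ?thesis
        by (intro exI[of _ "h # hs"] exI[of _ U']) blast
    qed
  qed
  obtain hs U where "linear U" "\<And>e. e \<in> Basis \<Longrightarrow> U e = 0"
    "\<And>y. y \<bullet> T y = y \<bullet> U y + (\<Sum>h\<leftarrow>hs. (h \<bullet> y)\<^sup>2)"
    using peel[OF finite_Basis] by blast
  moreover from this have "U y = 0" for y
    using linear_eq_stdbasis[of U "\<lambda>_. 0"] by (simp add: fun_eq_iff linear_iff)
  ultimately show ?thesis
    unfolding sum_of_squares_def by auto
qed

lemma pos_semidef_sum_of_squares:
  assumes "pos_semidef X"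
  shows "sum_of_squares (wnorm2 X)"
proof -
  have "y \<bullet> (X *v z) = (X *v y) \<bullet> z" for y z
    using assms unfolding pos_semidef_def
    by (metis dot_lmul_matrix transpose_matrix_vector)
  then show ?thesis
    unfolding wnorm2_def using assms
    by (intro psd_form_sum_of_squares) (auto simp: pos_semidef_def)
qed

section \<open>Second-order cone representability\<close>

definition socp_representable :: "'z::euclidean_space set \<Rightarrow> bool" where
  "socp_representable S \<longleftrightarrow> (\<exists>C. socp_feasible C = S)"

lemma is_socpI:
  assumes "linear J" and "socp_representable S"
  shows "is_socp J S"
proof -
  obtain C where "socp_feasible C = S"
    using assms unfolding socp_representable_def by blast
  then have "socp_feasible (C\<lparr>cost := adjoint J 1\<rparr>) = S"
    unfolding socp_feasible_def by simp
  moreover have "J z = adjoint J 1 \<bullet> z" for z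
    using adjoint_clauses(2)[OF assms(1), of 1 z] by simp
  ultimately show ?thesis
    unfolding is_socp_def by (intro exI[of _ "C\<lparr>cost := adjoint J 1\<rparr>"]) simp
qed

lemma socp_representable_conj:
  assumes "socp_representable {z. p z}" and "socp_representable {z. p' z}"
  shows "socp_representable {z. p z \<and> p' z}"
proof -
  obtain C C' where "socp_feasible C = {z. p z}" "socp_feasible C' = {z. p' z}"
    using assms unfolding socp_representable_def by blast
  moreover have "socp_feasible
      \<lparr>cost = 0, equalities = equalities C @ equalities C',
       inequalities = inequalities C @ inequalities C', cones = cones C @ cones C'\<rparr>
    = socp_feasible C \<inter> socp_feasible C'"
    unfolding socp_feasible_def by (simp add: ball_Un) blast
  ultimately show ?thesis
    unfolding socp_representable_def by (metis Collect_conj_eq)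
qed

lemma socp_representable_all:
  fixes p :: "'i::finite \<Rightarrow> 'z::euclidean_space \<Rightarrow> bool"
  assumes "\<And>i. socp_representable {z. p i z}"
  shows "socp_representable {z. \<forall>i. p i z}"
proof -
  have "socp_representable {z. \<forall>i\<in>I. p i z}" if "finite I" for I
    using that
  proof induction
    case empty
    have "socp_feasible \<lparr>cost = 0, equalities = [], inequalities = [], cones = []\<rparr>
        = {z::'z. \<forall>i\<in>{}. p i z}"
      unfolding socp_feasible_def by simp
    then show ?case
      unfolding socp_representable_def by blast
  next
    case (insert i I)
    then show ?case
      using socp_representable_conj[OF assms[of i] insert.IH] by simp
  qed
  from this[of UNIV] show ?thesis
    by simp
qed

lemma socp_representable_linear_le:
  fixes f :: "'z::euclidean_space \<Rightarrow> real"
  assumes "linear f"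
  shows "socp_representable {z. f z \<le> c}"
proof -
  have "socp_feasible \<lparr>cost = 0, equalities = [], inequalities = [(adjoint f 1, - c)], cones = []\<rparr>
      = {z. f z \<le> c}"
    unfolding socp_feasible_def by (simp add: adjoint_clauses[OF assms])
  then show ?thesis
    unfolding socp_representable_def by blast
qed

lemma socp_representable_linear_eq:
  fixes f :: "'z::euclidean_space \<Rightarrow> real"
  assumes "linear f"
  shows "socp_representable {z. f z = c}"
proof -
  have "socp_feasible \<lparr>cost = 0, equalities = [(adjoint f 1, - c)], inequalities = [], cones = []\<rparr>
      = {z. f z = c}"
    unfolding socp_feasible_def by (simp add: adjoint_clauses[OF assms])
  then show ?thesis
    unfolding socp_representable_def by blast
qed

lemma socp_representable_imp:
  assumes "a \<Longrightarrow> socp_representable {z. p z}"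
  shows "socp_representable {z :: 'z::euclidean_space. a \<longrightarrow> p z}"
proof (cases a)
  case False
  then show ?thesis
    using socp_representable_linear_eq[of "\<lambda>_. 0" 0] by (simp add: linear_iff)
qed (use assms in simp)

text \<open>
  The constraint reads \<open>4 q \<le> - 4 t\<close> with \<open>t = f - c\<close>. Because \<open>(1 - t)\<^sup>2 - (1 + t)\<^sup>2 = - 4 t\<close>, it says
  that the vector with the entries \<open>1 + t\<close> and \<open>2 (h \<bullet> z)\<close> has norm at most \<open>1 - t\<close>.
\<close>

lemma socp_representable_quadratic_le:
  assumes "sum_of_squares q" and "linear f"
  shows "socp_representable {z. q z + f z \<le> c}"
proof -
  obtain hs where q: "q z = (\<Sum>h\<leftarrow>hs. (h \<bullet> z)\<^sup>2)" for z
    using assms unfolding sum_of_squares_def by metis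
  define a where "a = adjoint f 1"
  have f: "f z = a \<bullet> z" for z
    unfolding a_def by (simp add: adjoint_clauses[OF assms(2)])
  define F where "F = (a, 1 - c) # map (\<lambda>h. (2 *\<^sub>R h, 0)) hs"
  have F: "(\<Sum>(h, g)\<leftarrow>F. (h \<bullet> z + g)\<^sup>2) = (f z - c + 1)\<^sup>2 + 4 * q z" for z
    by (simp add: F_def f q o_def power_mult_distrib algebra_simps
        sum_list_const_mult[symmetric])
  have "sqrt ((f z - c + 1)\<^sup>2 + 4 * q z) \<le> 1 - (f z - c) \<longleftrightarrow> q z + f z \<le> c" for z
  proof -
    have "0 \<le> q z"
      unfolding q by (intro sum_list_nonneg) auto
    moreover have "sqrt ((f z - c + 1)\<^sup>2 + 4 * q z) \<le> 1 - (f z - c) \<longleftrightarrow>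
        0 \<le> 1 - (f z - c) \<and> (f z - c + 1)\<^sup>2 + 4 * q z \<le> (1 - (f z - c))\<^sup>2"
      using \<open>0 \<le> q z\<close>
      by (smt (verit, best) real_le_lsqrt real_sqrt_ge_zero sqrt_le_D zero_le_power2)
    moreover have "(f z - c + 1)\<^sup>2 + 4 * q z \<le> (1 - (f z - c))\<^sup>2 \<longleftrightarrow> q z + f z \<le> c"
      by (simp add: power2_eq_square algebra_simps) linarith
    ultimately show ?thesis
      using \<open>0 \<le> q z\<close> by auto
  qed
  then have "sqrt (\<Sum>(h, g)\<leftarrow>F. (h \<bullet> z + g)\<^sup>2) \<le> - a \<bullet> z + (1 + c) \<longleftrightarrow> q z + f z \<le> c" for z
    unfolding F by (simp add: f algebra_simps)
  then have "socp_feasible \<lparr>cost = 0, equalities = [], inequalities = [], cones = [(F, - a, 1 + c)]\<rparr>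
      = {z. q z + f z \<le> c}"
    unfolding socp_feasible_def by simp
  then show ?thesis
    unfolding socp_representable_def by blast
qed

lemma convex_socp_feasible: "convex (socp_feasible C)"
proof -
  have cone: "convex {z. sqrt (\<Sum>(h, g)\<leftarrow>F. (h \<bullet> z + g)\<^sup>2) \<le> d \<bullet> z + e}"
    for F :: "('a \<times> real) list" and d e
  proof -
    define N where "N z = L2_set (\<lambda>i. fst (F ! i) \<bullet> z + snd (F ! i)) {0..<length F}" for z
    have N: "sqrt (\<Sum>(h, g)\<leftarrow>F. (h \<bullet> z + g)\<^sup>2) = N z" for z
      by (simp add: N_def L2_set_def sum_list_sum_nth case_prod_beta)
    have "N (s *\<^sub>R y + t *\<^sub>R z) \<le> s * N y + t * N z" if "0 \<le> s" "0 \<le> t" "s + t = 1" for s t y z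
    proof -
      have "fst (F ! i) \<bullet> (s *\<^sub>R y + t *\<^sub>R z) + snd (F ! i) =
          s * (fst (F ! i) \<bullet> y + snd (F ! i)) + t * (fst (F ! i) \<bullet> z + snd (F ! i))" for i
        using that(3) by (simp add: inner_simps algebra_simps flip: distrib_right)
      then show ?thesis
        using that unfolding N_def
        by (simp add: L2_set_right_distrib L2_set_triangle_ineq)
    qed
    note N_convex = this
    have "N (s *\<^sub>R y + t *\<^sub>R z) \<le> d \<bullet> (s *\<^sub>R y + t *\<^sub>R z) + e"
      if "N y \<le> d \<bullet> y + e" "N z \<le> d \<bullet> z + e" "0 \<le> s" "0 \<le> t" "s + t = 1" for s t y z
    proof -
      have "N (s *\<^sub>R y + t *\<^sub>R z) \<le> s * N y + t * N z"
        using that by (intro N_convex)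
      also have "\<dots> \<le> s * (d \<bullet> y + e) + t * (d \<bullet> z + e)"
        using that by (intro add_mono mult_left_mono)
      also have "\<dots> = d \<bullet> (s *\<^sub>R y + t *\<^sub>R z) + (s + t) * e"
        by (simp add: inner_simps algebra_simps)
      finally show ?thesis
        using that by simp
    qed
    then have "convex {z. N z \<le> d \<bullet> z + e}"
      by (auto simp: convex_def)
    then show ?thesis
      by (simp add: N)
  qed
  have "socp_feasible C =
      (\<Inter>(h, g)\<in>set (equalities C). {z. h \<bullet> z = - g}) \<inter>
      (\<Inter>(h, g)\<in>set (inequalities C). {z. h \<bullet> z \<le> - g}) \<inter>
      (\<Inter>(F, d, e)\<in>set (cones C). {z. sqrt (\<Sum>(h, g)\<leftarrow>F. (h \<bullet> z + g)\<^sup>2) \<le> d \<bullet> z + e})"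
    unfolding socp_feasible_def by (auto simp: add_eq_0_iff2 le_minus_iff algebra_simps add_eq_0_iff)
  also have "convex \<dots>"
    by (intro convex_Int convex_INT) (auto intro: cone convex_hyperplane convex_halfspace_le)
  finally show ?thesis .
qed

text \<open>
  One representation of the epigraph gives all three claims: \<open>S\<close> is a projection of the epigraph, and
  the epigraph of \<open>q\<close> over \<open>S\<close> is convex because it is the feasible set of a cone program.
\<close>

lemma socp_representable_epigraph:
  assumes "linear l" and "socp_representable {(z, \<tau>). z \<in> S \<and> q z \<le> \<tau>}"
  shows "is_epigraph_socp l q S" and "convex S" and "convex_on S (\<lambda>z. l z + q z)"
proof -
  have "linear (\<lambda>(z, \<tau>::real). l z + \<tau>)"
    using assms(1) by (auto simp: linear_iff algebra_simps)
  then show "is_epigraph_socp l q S"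
    unfolding is_epigraph_socp_def using assms(2) by (rule is_socpI)
  have conv: "convex {(z, \<tau>). z \<in> S \<and> q z \<le> \<tau>}"
    using assms(2) convex_socp_feasible unfolding socp_representable_def by metis
  then have q: "convex_on S q"
    by (simp add: convex_epigraph_convex epigraph_def case_prod_beta')
  have "S = fst ` {(z, \<tau>). z \<in> S \<and> q z \<le> \<tau>}"
    by force
  then show S: "convex S"
    using convex_linear_image[OF linear_fst conv] by metis
  have "convex_on S l"
    using assms(1) S by (auto simp: convex_on_def linear_iff)
  then show "convex_on S (\<lambda>z. l z + q z)"
    using q by (rule convex_on_add)
qed

section \<open>The affine Farkas lemma\<close>

text \<open>
  The valid inequalities \<open>(h, t)\<close> obtained from the rows by nonnegative combination and by relaxing the
  right-hand side form a finitely generated, hence closed, convex cone. If \<open>(h, t)\<close> is outside it, a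
  separating functional \<open>(a\<^sub>1, a\<^sub>2)\<close> is nonnegative on the cone, and the points
  \<open>(\<eta>\<^sub>0 - s a\<^sub>1) / (1 + s a\<^sub>2)\<close> with \<open>s \<ge> 0\<close> all satisfy \<open>H \<eta> \<le> k\<close>, but violate \<open>h \<bullet> \<eta> \<le> t\<close> for
  large \<open>s\<close>. This curve treats \<open>a\<^sub>2 > 0\<close> (it tends to a violating point) and \<open>a\<^sub>2 = 0\<close> (it is a
  violating ray) at once.
\<close>

lemma farkas_affine:
  fixes H :: "real^'n^'a" and k :: "real^'a" and h :: "real^'n"
  assumes nonempty: "H *v \<eta>\<^sub>0 \<le> k"
  shows "(\<forall>\<eta>. H *v \<eta> \<le> k \<longrightarrow> h \<bullet> \<eta> \<le> t) \<longleftrightarrow> (\<exists>z. 0 \<le> z \<and> z v* H = h \<and> z \<bullet> k \<le> t)"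
proof
  assume "\<exists>z. 0 \<le> z \<and> z v* H = h \<and> z \<bullet> k \<le> t"
  then obtain z where z: "0 \<le> z" "z v* H = h" "z \<bullet> k \<le> t"
    by blast
  show "\<forall>\<eta>. H *v \<eta> \<le> k \<longrightarrow> h \<bullet> \<eta> \<le> t"
  proof (intro allI impI)
    fix \<eta>
    assume "H *v \<eta> \<le> k"
    then have "z \<bullet> (H *v \<eta>) \<le> z \<bullet> k"
      using z(1) by (auto simp: inner_vec_def less_eq_vec_def intro!: sum_mono mult_left_mono)
    then show "h \<bullet> \<eta> \<le> t"
      using z by (simp add: dot_lmul_matrix[symmetric])
  qed
next
  assume bound: "\<forall>\<eta>. H *v \<eta> \<le> k \<longrightarrow> h \<bullet> \<eta> \<le> t"
  define C where "C = convex_cone hull (insert (0, 1) (range (\<lambda>i. (H $ i, k $ i))))"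
  have closed: "closed C"
    unfolding C_def by (rule closed_convex_cone_hull) simp
  \<comment> \<open>\<open>z\<close> collects the weights of the rows, \<open>s\<close> is the amount by which the right-hand side is relaxed\<close>
  have rep: "C \<subseteq> (\<lambda>(z, s). (z v* H, z \<bullet> k + s)) ` {(z, s). 0 \<le> z \<and> 0 \<le> s}"
    unfolding C_def
  proof (rule hull_minimal)
    have "linear (\<lambda>(z :: real^'a, s). (z v* H, z \<bullet> k + s))"
      by (auto simp: linear_iff vector_matrix_left_distrib inner_simps scaleR_vector_matrix_assoc
          algebra_simps)
    moreover have "convex_cone {(z :: real^'a, s :: real). 0 \<le> z \<and> 0 \<le> s}"
      by (auto simp: convex_cone_iff less_eq_vec_def mem_Times_iff)
    ultimately show "convex_cone ((\<lambda>(z, s). (z v* H, z \<bullet> k + s)) ` {(z, s). 0 \<le> z \<and> 0 \<le> s})"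
      using convex_cone_linear_image by blast
    have "(0, 1) \<in> (\<lambda>(z, s). (z v* H, z \<bullet> k + s)) ` {(z, s). 0 \<le> z \<and> 0 \<le> s}"
      by (rule image_eqI[where x = "(0, 1)"]) simp_all
    moreover have "(H $ i, k $ i) \<in> (\<lambda>(z, s). (z v* H, z \<bullet> k + s)) ` {(z, s). 0 \<le> z \<and> 0 \<le> s}" for i
    proof (rule image_eqI[where x = "(axis i 1, 0)"])
      have "axis i 1 v* H = H $ i"
        by (simp add: vector_matrix_mult_def vec_eq_iff axis_def if_distrib if_distribR cong: if_cong)
      then show "(H $ i, k $ i) = (case (axis i 1, 0) of (z, s) \<Rightarrow> (z v* H, z \<bullet> k + s))"
        by (simp add: inner_axis')
    qed (simp add: less_eq_vec_def axis_def)
    ultimately show "insert (0, 1) (range (\<lambda>i. (H $ i, k $ i)))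
        \<subseteq> (\<lambda>(z, s). (z v* H, z \<bullet> k + s)) ` {(z, s). 0 \<le> z \<and> 0 \<le> s}"
      by (simp only: insert_subset image_subset_iff ball_UNIV simp_thms)
  qed
  have "(h, t) \<in> C"
  proof (rule ccontr)
    assume "(h, t) \<notin> C"
    moreover have "convex C"
      unfolding C_def by (rule convex_convex_cone_hull)
    ultimately obtain a r where a: "a \<bullet> (h, t) < r" "\<forall>g\<in>C. r < a \<bullet> g"
      using separating_hyperplane_closed_point[of C "(h, t)"] closed by blast
    obtain a\<^sub>1 a\<^sub>2 where "a = (a\<^sub>1, a\<^sub>2)"
      by (rule prod.exhaust)
    with a have sep: "(a\<^sub>1, a\<^sub>2) \<bullet> (h, t) < r" "\<And>g. g \<in> C \<Longrightarrow> r < (a\<^sub>1, a\<^sub>2) \<bullet> g"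
      by blast+
    have "r < 0"
      using sep(2)[of 0] by (simp add: C_def convex_cone_hull_contains_0)
    \<comment> \<open>a negative value could be scaled within the cone to the level \<open>r\<close>, which is not attained\<close>
    have nonneg: "0 \<le> (a\<^sub>1, a\<^sub>2) \<bullet> g" if "g \<in> C" for g
    proof (rule ccontr)
      let ?v = "(a\<^sub>1, a\<^sub>2) \<bullet> g"
      assume "\<not> 0 \<le> ?v"
      moreover from this have "(r / ?v) *\<^sub>R g \<in> C"
        using \<open>r < 0\<close> that unfolding C_def by (intro convex_cone_hull_mul) (auto simp: divide_nonpos_neg)
      ultimately show False
        using sep(2)[of "(r / ?v) *\<^sub>R g"] by (simp del: scaleR_Pair inner_Pair)
    qed
    have a\<^sub>2: "0 \<le> a\<^sub>2"
      using nonneg[of "(0, 1)"] by (simp add: C_def hull_inc)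
    have row: "0 \<le> a\<^sub>1 \<bullet> H $ i + a\<^sub>2 * k $ i" for i
      using nonneg[of "(H $ i, k $ i)"] by (simp add: C_def hull_inc)
    have neg: "a\<^sub>1 \<bullet> h + a\<^sub>2 * t < 0"
      using sep(1) \<open>r < 0\<close> by simp
    have ray: "h \<bullet> \<eta>\<^sub>0 - t \<le> s * (a\<^sub>1 \<bullet> h + a\<^sub>2 * t)" if "0 \<le> s" for s
    proof -
      define m where "m = 1 + s * a\<^sub>2"
      have m: "m > 0"
        using that a\<^sub>2 by (simp add: m_def add_pos_nonneg)
      have "H *v ((1 / m) *\<^sub>R (\<eta>\<^sub>0 - s *\<^sub>R a\<^sub>1)) \<le> k"
        unfolding less_eq_vec_def
      proof
        fix i
        have "s * (a\<^sub>1 \<bullet> H $ i + a\<^sub>2 * k $ i) \<ge> 0"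
          using row that by simp
        moreover have "H $ i \<bullet> \<eta>\<^sub>0 \<le> k $ i"
          using nonempty by (simp add: less_eq_vec_def matrix_vector_mul_component)
        ultimately have "H $ i \<bullet> (\<eta>\<^sub>0 - s *\<^sub>R a\<^sub>1) \<le> m * k $ i"
          by (simp add: m_def inner_simps inner_commute algebra_simps)
        then show "(H *v ((1 / m) *\<^sub>R (\<eta>\<^sub>0 - s *\<^sub>R a\<^sub>1))) $ i \<le> k $ i"
          using m by (simp add: matrix_vector_mul_component pos_divide_le_eq mult.commute
              del: scaleR_right_diff_distrib)
      qed
      then have "h \<bullet> ((1 / m) *\<^sub>R (\<eta>\<^sub>0 - s *\<^sub>R a\<^sub>1)) \<le> t"
        using bound by blast
      then have "h \<bullet> (\<eta>\<^sub>0 - s *\<^sub>R a\<^sub>1) \<le> m * t"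
        using m by (simp add: pos_divide_le_eq mult.commute del: scaleR_right_diff_distrib)
      then show ?thesis
        by (simp add: m_def inner_simps inner_commute algebra_simps)
    qed
    define l where "l = a\<^sub>1 \<bullet> h + a\<^sub>2 * t"
    define s where "s = (\<bar>h \<bullet> \<eta>\<^sub>0 - t\<bar> + 1) / - l"
    have "l < 0"
      using neg by (simp add: l_def)
    then have "s * l = - (\<bar>h \<bullet> \<eta>\<^sub>0 - t\<bar> + 1)"
      by (simp add: s_def)
    moreover have "0 \<le> s"
      unfolding s_def using \<open>l < 0\<close> by (intro divide_nonneg_pos) simp_all
    ultimately show False
      using ray[of s] unfolding l_def by linarith
  qed
  then show "\<exists>z. 0 \<le> z \<and> z v* H = h \<and> z \<bullet> k \<le> t"
    using rep by force
qed

lemma matrix_mult_row: "(X ** Y) $ i = X $ i v* Y"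
  by (simp add: matrix_matrix_mult_def vector_matrix_mult_def vec_eq_iff)

text \<open>
  Column \<open>s\<close> of \<open>Z\<close> is the multiplier that the Farkas lemma provides for row \<open>s\<close> of the constraint.
\<close>

lemma robust_linear_constraint_iff:
  fixes H :: "real^'n^'a" and K :: "real^'n^'u" and H\<^sub>u :: "real^'u^'s"
  assumes "H *v \<eta>\<^sub>0 \<le> k"
  shows "(\<forall>\<eta>. H *v \<eta> \<le> k \<longrightarrow> H\<^sub>u *v (K *v \<eta> + v) \<le> k\<^sub>u) \<longleftrightarrow>
    (\<exists>Z. H\<^sub>u *v v + transpose Z *v k \<le> k\<^sub>u \<and> transpose Z ** H = H\<^sub>u ** K \<and> 0 \<le> Z)"
proof -
  have row: "(H\<^sub>u *v (K *v \<eta> + v)) $ s = (H\<^sub>u ** K) $ s \<bullet> \<eta> + (H\<^sub>u *v v) $ s" for \<eta> s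
    by (simp add: matrix_vector_right_distrib matrix_vector_mul_assoc matrix_vector_mul_component)
  have "(\<forall>\<eta>. H *v \<eta> \<le> k \<longrightarrow> H\<^sub>u *v (K *v \<eta> + v) \<le> k\<^sub>u) \<longleftrightarrow>
      (\<forall>s. \<forall>\<eta>. H *v \<eta> \<le> k \<longrightarrow> (H\<^sub>u ** K) $ s \<bullet> \<eta> \<le> k\<^sub>u $ s - (H\<^sub>u *v v) $ s)"
    unfolding less_eq_vec_def[of "H\<^sub>u *v _"] row by (auto simp: algebra_simps)
  also have "\<dots> \<longleftrightarrow> (\<forall>s. \<exists>z. 0 \<le> z \<and> z v* H = (H\<^sub>u ** K) $ s \<and> z \<bullet> k \<le> k\<^sub>u $ s - (H\<^sub>u *v v) $ s)"
    by (simp add: farkas_affine[OF assms])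
  also have "\<dots> \<longleftrightarrow> (\<exists>Y :: real^'a^'s. \<forall>s. 0 \<le> Y $ s \<and> Y $ s v* H = (H\<^sub>u ** K) $ s
      \<and> Y $ s \<bullet> k \<le> k\<^sub>u $ s - (H\<^sub>u *v v) $ s)"
  proof
    assume "\<forall>s. \<exists>z. 0 \<le> z \<and> z v* H = (H\<^sub>u ** K) $ s \<and> z \<bullet> k \<le> k\<^sub>u $ s - (H\<^sub>u *v v) $ s"
    then obtain z where "\<forall>s. 0 \<le> z s \<and> z s v* H = (H\<^sub>u ** K) $ s \<and> z s \<bullet> k \<le> k\<^sub>u $ s - (H\<^sub>u *v v) $ s"
      by metis
    then show "\<exists>Y :: real^'a^'s. \<forall>s. 0 \<le> Y $ s \<and> Y $ s v* H = (H\<^sub>u ** K) $ s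
        \<and> Y $ s \<bullet> k \<le> k\<^sub>u $ s - (H\<^sub>u *v v) $ s"
      by (intro exI[of _ "\<chi> s. z s"]) simp
  qed blast
  also have "\<dots> \<longleftrightarrow> (\<exists>Y :: real^'a^'s. H\<^sub>u *v v + Y *v k \<le> k\<^sub>u \<and> Y ** H = H\<^sub>u ** K \<and> 0 \<le> transpose Y)"
  proof -
    have "(\<forall>s. 0 \<le> Y $ s \<and> Y $ s v* H = (H\<^sub>u ** K) $ s \<and> Y $ s \<bullet> k \<le> k\<^sub>u $ s - (H\<^sub>u *v v) $ s) \<longleftrightarrow>
        H\<^sub>u *v v + Y *v k \<le> k\<^sub>u \<and> Y ** H = H\<^sub>u ** K \<and> 0 \<le> transpose Y" for Y :: "real^'a^'s"
    proof -
      have "(\<forall>s. 0 \<le> Y $ s) \<longleftrightarrow> 0 \<le> transpose Y"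
        by (auto simp: less_eq_vec_def transpose_def)
      moreover have "(\<forall>s. Y $ s v* H = (H\<^sub>u ** K) $ s) \<longleftrightarrow> Y ** H = H\<^sub>u ** K"
        by (subst vec_eq_iff) (simp add: matrix_mult_row)
      moreover have "(\<forall>s. Y $ s \<bullet> k \<le> k\<^sub>u $ s - (H\<^sub>u *v v) $ s) \<longleftrightarrow> H\<^sub>u *v v + Y *v k \<le> k\<^sub>u"
        by (auto simp: less_eq_vec_def matrix_vector_mul_component algebra_simps)
      ultimately show ?thesis
        by blast
    qed
    then show ?thesis
      by simp
  qed
  also have "\<dots> \<longleftrightarrow> (\<exists>Z. H\<^sub>u *v v + transpose Z *v k \<le> k\<^sub>u \<and> transpose Z ** H = H\<^sub>u ** K \<and> 0 \<le> Z)"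
    by (metis transpose_transpose)
  finally show ?thesis .
qed

section \<open>Frobenius inner products and Kronecker products\<close>

text \<open>
  The inner product on matrices is the Frobenius product. This identity isolates the data of a
  bilinear expression from its matrix, so that an expectation acts on the outer product alone.
\<close>

lemma inner_matrix_vector_outer:
  fixes K :: "real^'n^'m"
  shows "x \<bullet> (K *v y) = K \<bullet> outer x y"
  by (simp add: inner_vec_def matrix_vector_mult_def outer_def sum_distrib_left mult_ac)

lemma outer_mult_vector: "outer y z *v x = (z \<bullet> x) *\<^sub>R y"
  by (simp add: outer_def matrix_vector_mult_def inner_vec_def vec_eq_iff sum_distrib_left mult_ac)

lemma inner_matrix_mult_left:
  fixes X :: "real^'n^'m"
  shows "(X ** Y) \<bullet> Z = Y \<bullet> (transpose X ** Z)"
proof -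
  have "(X ** Y) \<bullet> Z = (\<Sum>i\<in>UNIV. \<Sum>k\<in>UNIV. \<Sum>j\<in>UNIV. X $ i $ j * Y $ j $ k * Z $ i $ k)"
    by (simp add: inner_vec_def matrix_matrix_mult_def sum_distrib_right)
  also have "\<dots> = (\<Sum>i\<in>UNIV. \<Sum>j\<in>UNIV. \<Sum>k\<in>UNIV. X $ i $ j * Y $ j $ k * Z $ i $ k)"
    by (intro sum.cong refl sum.swap)
  also have "\<dots> = (\<Sum>j\<in>UNIV. \<Sum>i\<in>UNIV. \<Sum>k\<in>UNIV. X $ i $ j * Y $ j $ k * Z $ i $ k)"
    by (rule sum.swap)
  also have "\<dots> = (\<Sum>j\<in>UNIV. \<Sum>k\<in>UNIV. \<Sum>i\<in>UNIV. X $ i $ j * Y $ j $ k * Z $ i $ k)"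
    by (intro sum.cong refl sum.swap)
  also have "\<dots> = Y \<bullet> (transpose X ** Z)"
    by (simp add: inner_vec_def matrix_matrix_mult_def transpose_def sum_distrib_left mult_ac)
  finally show ?thesis .
qed

lemma inner_transpose:
  fixes X :: "real^'n^'m"
  shows "transpose X \<bullet> Y = X \<bullet> transpose Y"
  unfolding inner_vec_def transpose_def by (simp, rule sum.swap)

lemma inner_matrix_mult_right:
  fixes X :: "real^'n^'m"
  shows "(X ** Y) \<bullet> Z = X \<bullet> (Z ** transpose Y)"
proof -
  have "(X ** Y) \<bullet> Z = (transpose Y ** transpose X) \<bullet> transpose Z"
    by (metis inner_transpose matrix_transpose_mul transpose_transpose)
  also have "\<dots> = transpose X \<bullet> (Y ** transpose Z)"
    by (simp add: inner_matrix_mult_left)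
  also have "\<dots> = X \<bullet> (Z ** transpose Y)"
    by (simp add: inner_transpose matrix_transpose_mul)
  finally show ?thesis .
qed

lemma inner_matrix_vector_congruence:
  fixes Y :: "real^'n^'m"
  shows "(Y *v y) \<bullet> (X *v (Z *v z)) = y \<bullet> ((transpose Y ** X ** Z) *v z)"
  by (metis dot_lmul_matrix matrix_vector_mul_assoc vector_transpose_matrix)

lemma matrix_add_rdistrib:
  fixes X :: "'b::semiring_1^'n^'m"
  shows "(X + Y) ** Z = X ** Z + Y ** Z"
  by (simp add: matrix_matrix_mult_def vec_eq_iff sum.distrib distrib_right)

lemma transpose_add: "transpose (X + Y) = transpose X + transpose Y"
  by (simp add: transpose_def vec_eq_iff)

lemma linear_vectorize: "linear vectorize"
  by (simp add: linear_iff vectorize_def vec_eq_iff)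

lemma vectorize_surj: "\<exists>M. z = vectorize M"
  by (rule exI[of _ "\<chi> r c. z $ (c, r)"]) (simp add: vectorize_def vec_eq_iff)

lemma inner_vectorize: "vectorize X \<bullet> vectorize Y = X \<bullet> Y"
proof -
  have "vectorize X \<bullet> vectorize Y = (\<Sum>j\<in>UNIV. \<Sum>i\<in>UNIV. X $ i $ j * Y $ i $ j)"
    by (simp add: inner_vec_def vectorize_def sum.cartesian_product case_prod_beta flip: UNIV_Times_UNIV)
  also have "\<dots> = X \<bullet> Y"
    unfolding inner_vec_def by (simp, rule sum.swap)
  finally show ?thesis .
qed

lemma kron_mult_vectorize:
  "kron X Y *v vectorize M = vectorize (Y ** M ** transpose X)"
proof -
  have "(kron X Y *v vectorize M) $ (c, r) = vectorize (Y ** M ** transpose X) $ (c, r)" for c r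
  proof -
    have "(kron X Y *v vectorize M) $ (c, r) =
        (\<Sum>c'\<in>UNIV. \<Sum>r'\<in>UNIV. X $ c $ c' * Y $ r $ r' * M $ r' $ c')"
      by (simp add: kron_def matrix_vector_mult_def vectorize_def sum.cartesian_product
          case_prod_beta flip: UNIV_Times_UNIV)
    also have "\<dots> = vectorize (Y ** M ** transpose X) $ (c, r)"
      by (simp add: vectorize_def matrix_matrix_mult_def transpose_def sum_distrib_left mult_ac)
    finally show ?thesis .
  qed
  then show ?thesis
    by (auto simp: vec_eq_iff)
qed

lemma transpose_kron: "transpose (kron X Y) = kron (transpose X) (transpose Y)"
  by (simp add: kron_def transpose_def vec_eq_iff)

lemma wnorm2_kron_vectorize:
  "wnorm2 (kron X Y) (vectorize M) = (transpose M ** Y ** M) \<bullet> X"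
proof -
  have "wnorm2 (kron X Y) (vectorize M) = (Y ** M ** transpose X) \<bullet> M"
    by (simp add: wnorm2_def kron_mult_vectorize inner_vectorize inner_commute)
  also have "\<dots> = (Y ** M) \<bullet> (M ** X)"
    by (simp add: inner_matrix_mult_right[of _ "transpose X"])
  also have "\<dots> = (transpose M ** (Y ** M)) \<bullet> X"
    by (simp add: inner_matrix_mult_left[of "transpose M"])
  finally show ?thesis
    by (simp add: matrix_mul_assoc)
qed

lemma wnorm2_add:
  assumes "transpose X = X"
  shows "wnorm2 X (y + z) = wnorm2 X y + 2 * (y \<bullet> (X *v z)) + wnorm2 X z"
proof -
  have "z \<bullet> (X *v y) = y \<bullet> (X *v z)"
    using assms by (metis dot_lmul_matrix inner_commute transpose_matrix_vector)
  then show ?thesis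
    by (simp add: wnorm2_def matrix_vector_right_distrib inner_simps)
qed

text \<open>The form of \<open>X - Y\<close> vanishes identically, so it is positive semidefinite with null vectors only.\<close>

lemma symmetric_matrix_eqI:
  assumes "transpose X = X" "transpose Y = Y" and "\<And>z. wnorm2 X z = wnorm2 Y z"
  shows "X = Y"
proof -
  have "(X - Y) *v z = 0" for z
  proof (rule psd_form_null_imp_kernel[where T = "(*v) (X - Y)"])
    show "linear ((*v) (X - Y))"
      by simp
    have "x \<bullet> (X *v z) = (X *v x) \<bullet> z" "x \<bullet> (Y *v z) = (Y *v x) \<bullet> z" for x z
      using assms by (metis dot_lmul_matrix transpose_matrix_vector)+
    then show "x \<bullet> ((X - Y) *v z) = ((X - Y) *v x) \<bullet> z" for x z
      by (simp add: matrix_vector_mult_diff_rdistrib inner_simps)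
  qed (use assms(3) in \<open>simp_all add: matrix_vector_mult_diff_rdistrib inner_simps wnorm2_def\<close>)
  then show ?thesis
    by (simp add: matrix_eq matrix_vector_mult_diff_rdistrib)
qed

text \<open>
  The sum of squares for the quadratic form determines the matrix itself, since a symmetric matrix
  is determined by its quadratic form.
\<close>

lemma pos_semidef_sum_outer:
  assumes "pos_semidef X"
  obtains hs where "X = (\<Sum>h\<leftarrow>hs. outer h h)"
proof -
  obtain hs where hs: "wnorm2 X z = (\<Sum>h\<leftarrow>hs. (h \<bullet> z)\<^sup>2)" for z
    using pos_semidef_sum_of_squares[OF assms] unfolding sum_of_squares_def by blast
  have "wnorm2 (\<Sum>h\<leftarrow>hs. outer h h) z = (\<Sum>h\<leftarrow>hs. (h \<bullet> z)\<^sup>2)" for z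
    by (induction hs) (simp_all add: wnorm2_def matrix_vector_mult_add_rdistrib inner_simps outer_mult_vector
        power2_eq_square inner_commute)
  moreover have "transpose (\<Sum>h\<leftarrow>hs. outer h h) = (\<Sum>h\<leftarrow>hs. outer h h)"
    by (induction hs) (simp_all add: transpose_def vec_eq_iff outer_def)
  ultimately show thesis
    using that symmetric_matrix_eqI[of X] hs assms by (simp add: pos_semidef_def)
qed

lemma pos_semidef_congruence:
  assumes "pos_semidef X"
  shows "pos_semidef (transpose Y ** X ** Y)"
proof -
  have "z \<bullet> ((transpose Y ** X ** Y) *v z) = (Y *v z) \<bullet> (X *v (Y *v z))" for z
    by (metis dot_lmul_matrix matrix_vector_mul_assoc vector_transpose_matrix)
  then show ?thesis
    using assms by (simp add: pos_semidef_def matrix_transpose_mul matrix_mul_assoc)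
qed

lemma pos_semidef_add:
  assumes "pos_semidef X" "pos_semidef Y"
  shows "pos_semidef (X + Y)"
  using assms by (simp add: pos_semidef_def matrix_vector_mult_add_rdistrib inner_simps
      transpose_def vec_eq_iff)

text \<open>
  On vectorized matrices the form is \<open>(M\<^sup>T Y M) \<bullet> X\<close>, a Frobenius product of two positive semidefinite
  matrices; splitting \<open>X\<close> into rank-one terms \<open>h h\<^sup>T\<close> turns it into a sum of the nonnegative numbers
  \<open>h \<bullet> (M\<^sup>T Y M h)\<close>.
\<close>

lemma pos_semidef_kron:
  assumes "pos_semidef X" "pos_semidef Y"
  shows "pos_semidef (kron X Y)"
proof -
  obtain hs where hs: "X = (\<Sum>h\<leftarrow>hs. outer h h)"
    using pos_semidef_sum_outer[OF assms(1)] .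
  have "0 \<le> z \<bullet> (kron X Y *v z)" for z
  proof -
    obtain M where M: "z = vectorize M"
      using vectorize_surj by blast
    let ?K = "transpose M ** Y ** M"
    have "pos_semidef ?K"
      using assms(2) by (rule pos_semidef_congruence)
    then have "0 \<le> ?K \<bullet> outer h h" for h
      by (simp add: pos_semidef_def flip: inner_matrix_vector_outer)
    then have "0 \<le> ?K \<bullet> X"
      unfolding hs by (induction hs) (simp_all add: inner_simps)
    then show ?thesis
      using wnorm2_kron_vectorize[of X Y M] by (simp add: M wnorm2_def)
  qed
  then show ?thesis
    using assms by (simp add: pos_semidef_def transpose_kron)
qed

lemma pos_semidef_block_diag: "pos_semidef X \<Longrightarrow> pos_semidef (block_diag X)"
  unfolding block_diag_def by (rule pos_semidef_kron) (simp_all add: pos_semidef_def)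

section \<open>Second moments of random vectors\<close>

lemma borel_measurable_vec_iff:
  fixes f :: "'o \<Rightarrow> real^'n"
  shows "f \<in> borel_measurable P \<longleftrightarrow> (\<forall>i. (\<lambda>\<omega>. f \<omega> $ i) \<in> borel_measurable P)"
  by (subst borel_measurable_euclidean_space) (auto simp: Basis_vec_def inner_axis)

lemma integrable_componentwise_Basis:
  fixes f :: "'o \<Rightarrow> 'b::euclidean_space"
  assumes "\<And>b. b \<in> Basis \<Longrightarrow> integrable P (\<lambda>\<omega>. f \<omega> \<bullet> b)"
  shows "integrable P f"
proof -
  have "integrable P (\<lambda>\<omega>. \<Sum>b\<in>Basis. (f \<omega> \<bullet> b) *\<^sub>R b)"
    using assms by (intro Bochner_Integration.integrable_sum integrable_scaleR_left) auto
  then show ?thesis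
    by (simp add: euclidean_representation)
qed

lemma expectation_vec_nth:
  fixes f :: "'o \<Rightarrow> 'b::euclidean_space^'n"
  assumes "integrable P f"
  shows "integral\<^sup>L P f $ i = (\<integral>\<omega>. f \<omega> $ i \<partial>P)"
  using integral_bounded_linear[OF bounded_linear_vec_nth assms] by simp

lemma square_integrable_integrable_mult:
  assumes "square_integrable P X" "square_integrable P Y"
  shows "integrable P (\<lambda>\<omega>. X \<omega> $ i * Y \<omega> $ j)"
proof (rule Bochner_Integration.integrable_bound)
  show "integrable P (\<lambda>\<omega>. (X \<omega> $ i)\<^sup>2 + (Y \<omega> $ j)\<^sup>2)"
    using assms by (auto simp: square_integrable_def)
  show "(\<lambda>\<omega>. X \<omega> $ i * Y \<omega> $ j) \<in> borel_measurable P"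
    using assms by (intro borel_measurable_times) (auto simp: square_integrable_def borel_measurable_vec_iff)
  have "\<bar>s * t\<bar> \<le> s\<^sup>2 + t\<^sup>2" for s t :: real
  proof -
    have "2 * \<bar>s * t\<bar> \<le> s\<^sup>2 + t\<^sup>2"
      using sum_squares_bound[of "\<bar>s\<bar>" "\<bar>t\<bar>"] by (simp add: abs_mult)
    then show ?thesis
      using abs_ge_zero[of "s * t"] by linarith
  qed
  then show "AE \<omega> in P. norm (X \<omega> $ i * Y \<omega> $ j) \<le> norm ((X \<omega> $ i)\<^sup>2 + (Y \<omega> $ j)\<^sup>2)"
    by simp
qed

lemma square_integrable_integrable_outer:
  assumes "square_integrable P X" "square_integrable P Y"
  shows "integrable P (\<lambda>\<omega>. outer (X \<omega>) (Y \<omega>))"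
  by (rule integrable_componentwise_Basis)
    (auto simp: Basis_vec_def inner_axis outer_def square_integrable_integrable_mult[OF assms])

lemma expectation_bilinear:
  assumes "square_integrable P X" "square_integrable P Y"
  shows "integrable P (\<lambda>\<omega>. X \<omega> \<bullet> (K *v Y \<omega>))"
    and "(\<integral>\<omega>. X \<omega> \<bullet> (K *v Y \<omega>) \<partial>P) = K \<bullet> (\<integral>\<omega>. outer (X \<omega>) (Y \<omega>) \<partial>P)"
  using square_integrable_integrable_outer[OF assms] by (simp_all add: inner_matrix_vector_outer)

lemma square_integrable_stack:
  fixes w :: "'p::finite \<Rightarrow> 'o \<Rightarrow> real^'n"
  assumes "\<And>p. square_integrable P (w p)"
  shows "square_integrable P (\<lambda>\<omega>. stack (\<lambda>p. w p \<omega>))"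
  using assms by (simp add: square_integrable_def borel_measurable_vec_iff stack_def)

lemma saturate_borel_measurable:
  assumes "\<And>i l. \<phi> i l \<in> borel_measurable borel" and "X \<in> borel_measurable P"
  shows "(\<lambda>\<omega>. saturate \<phi> (X \<omega>)) \<in> borel_measurable P"
  unfolding borel_measurable_vec_iff
proof
  fix k
  have "(\<lambda>\<omega>. X \<omega> $ k) \<in> borel_measurable P"
    using assms(2) unfolding borel_measurable_vec_iff by blast
  from measurable_compose[OF this assms(1)]
  show "(\<lambda>\<omega>. saturate \<phi> (X \<omega>) $ k) \<in> borel_measurable P"
    by (simp add: saturate_def)
qed

lemma distributed_AE_density_nonzero:
  assumes "distributed P N X f"
  shows "AE \<omega> in P. f (X \<omega>) \<noteq> 0"
proof -
  have "AE z in density N f. f z \<noteq> 0"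
    using assms by (simp add: distributed_def AE_density zero_less_iff_neq_zero)
  then have "AE z in distr P N X. f z \<noteq> 0"
    using assms by (simp only: distributed_def)
  then show ?thesis
    using assms by (intro AE_distrD[of X P N]) (auto simp: distributed_def)
qed

context prob_space
begin

lemma square_integrable_const:
  fixes x :: "real^'n"
  shows "square_integrable M (\<lambda>_. x)"
  by (simp add: square_integrable_def)

lemma square_integrable_integrable:
  fixes X :: "'a \<Rightarrow> real^'n"
  assumes "square_integrable M X"
  shows "integrable M X"
proof (rule integrable_componentwise_Basis)
  fix b :: "real^'n"
  assume "b \<in> Basis"
  then obtain i where b: "b = axis i 1"
    by (auto simp: Basis_vec_def)
  have "integrable M (\<lambda>\<omega>. X \<omega> $ i * 1 $ i)"
    by (rule square_integrable_integrable_mult[OF assms square_integrable_const])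
  then show "integrable M (\<lambda>\<omega>. X \<omega> \<bullet> b)"
    by (simp add: b inner_axis)
qed

lemma square_integrable_add:
  fixes X :: "'a \<Rightarrow> real^'n"
  assumes "square_integrable M X" "square_integrable M Y"
  shows "square_integrable M (\<lambda>\<omega>. X \<omega> + Y \<omega>)"
proof -
  have "integrable M (\<lambda>\<omega>. (X \<omega> $ i)\<^sup>2 + (Y \<omega> $ i)\<^sup>2 + 2 * (X \<omega> $ i * Y \<omega> $ i))" for i
    using assms square_integrable_integrable_mult[OF assms] by (auto simp: square_integrable_def)
  then show ?thesis
    using assms by (auto simp: square_integrable_def power2_sum mult.assoc)
qed

lemma square_integrable_matrix:
  fixes X :: "'a \<Rightarrow> real^'n"
  assumes "square_integrable M X"
  shows "square_integrable M (\<lambda>\<omega>. K *v X \<omega>)"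
  unfolding square_integrable_def
proof (intro conjI allI)
  show "(\<lambda>\<omega>. K *v X \<omega>) \<in> borel_measurable M"
    using assms unfolding square_integrable_def borel_measurable_vec_iff
    by (auto simp: matrix_vector_mult_def intro!: borel_measurable_sum borel_measurable_times)
  have "((K *v X \<omega>) $ i)\<^sup>2 = (\<Sum>j\<in>UNIV. \<Sum>k\<in>UNIV. K $ i $ j * K $ i $ k * (X \<omega> $ j * X \<omega> $ k))"
    for i \<omega>
    by (simp add: matrix_vector_mult_def power2_eq_square sum_product mult_ac)
  then show "integrable M (\<lambda>\<omega>. ((K *v X \<omega>) $ i)\<^sup>2)" for i
    using square_integrable_integrable_mult[OF assms assms] by simp
qed

lemma square_integrable_bounded:
  fixes X :: "'a \<Rightarrow> real^'n"
  assumes "X \<in> borel_measurable M" "\<And>\<omega> i. \<bar>X \<omega> $ i\<bar> \<le> r"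
  shows "square_integrable M X"
  unfolding square_integrable_def
proof (intro conjI allI)
  fix i
  have "(X \<omega> $ i)\<^sup>2 \<le> r\<^sup>2" for \<omega>
    using assms(2)[of \<omega> i] by (simp add: abs_le_square_iff[symmetric])
  then show "integrable M (\<lambda>\<omega>. (X \<omega> $ i)\<^sup>2)"
    using assms(1) by (intro integrable_const_bound[of _ "r\<^sup>2"])
      (auto simp: borel_measurable_vec_iff intro: borel_measurable_power)
qed (fact assms(1))

lemma expectation_matrix_vector:
  fixes X :: "'a \<Rightarrow> real^'n"
  assumes "integrable M X"
  shows "integrable M (\<lambda>\<omega>. K *v X \<omega>)" and "expectation (\<lambda>\<omega>. K *v X \<omega>) = K *v expectation X"
  using assms integrable_bounded_linear[OF matrix_vector_mul_bounded_linear]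
    integral_bounded_linear[OF matrix_vector_mul_bounded_linear] by auto

lemma expectation_linear_form_zero:
  fixes X :: "'a \<Rightarrow> real^'n"
  assumes "integrable M X" and "expectation X = 0"
  shows "integrable M (\<lambda>\<omega>. a \<bullet> (K *v X \<omega>))" and "expectation (\<lambda>\<omega>. a \<bullet> (K *v X \<omega>)) = 0"
  using assms by (simp_all add: dot_lmul_matrix[symmetric])

lemma expectation_stack_zero:
  fixes w :: "'p::finite \<Rightarrow> 'a \<Rightarrow> real^'n"
  assumes "\<And>p. square_integrable M (w p)" and "\<And>p. expectation (w p) = 0"
  shows "expectation (\<lambda>\<omega>. stack (\<lambda>p. w p \<omega>)) = 0"
proof -
  have "expectation (\<lambda>\<omega>. stack (\<lambda>p. w p \<omega>)) $ k = 0" for k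
    using expectation_vec_nth[OF square_integrable_integrable[OF square_integrable_stack[OF assms(1)]], where i = k]
      expectation_vec_nth[OF square_integrable_integrable[OF assms(1)], where i = "snd k"] assms(2)
    by (simp add: stack_def)
  then show ?thesis
    by (simp add: vec_eq_iff)
qed

lemma covariance_shift:
  fixes X :: "'a \<Rightarrow> real^'n"
  assumes "square_integrable M X" and "expectation X = 0"
  shows "expectation (\<lambda>\<omega>. m + X \<omega>) = m"
    and "covariance M (\<lambda>\<omega>. m + X \<omega>) = expectation (\<lambda>\<omega>. outer (X \<omega>) (X \<omega>))"
proof -
  show mean: "expectation (\<lambda>\<omega>. m + X \<omega>) = m"
    using square_integrable_integrable[OF assms(1)] assms(2) by (simp add: prob_space)
  show "covariance M (\<lambda>\<omega>. m + X \<omega>) = expectation (\<lambda>\<omega>. outer (X \<omega>) (X \<omega>))"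
    by (simp add: covariance_def mean)
qed

lemma second_moment_pos_semidef:
  fixes X :: "'a \<Rightarrow> real^'n"
  assumes "square_integrable M X"
  shows "pos_semidef (expectation (\<lambda>\<omega>. outer (X \<omega>) (X \<omega>)))" (is "pos_semidef ?\<Omega>")
proof -
  note int = square_integrable_integrable_outer[OF assms assms]
  have "?\<Omega> $ i $ j = expectation (\<lambda>\<omega>. outer (X \<omega>) (X \<omega>) $ i $ j)" for i j
    using expectation_vec_nth[OF int] integrable_bounded_linear[OF bounded_linear_vec_nth int]
    by (simp add: expectation_vec_nth)
  then have "transpose ?\<Omega> = ?\<Omega>"
    by (simp add: transpose_def outer_def vec_eq_iff mult.commute)
  moreover have "0 \<le> y \<bullet> (?\<Omega> *v y)" for y
  proof -
    have "outer y y \<bullet> outer (X \<omega>) (X \<omega>) = (X \<omega> \<bullet> y)\<^sup>2" for \<omega>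
      by (simp add: inner_vec_def outer_def power2_eq_square sum_product mult_ac)
    then have "y \<bullet> (?\<Omega> *v y) = expectation (\<lambda>\<omega>. (X \<omega> \<bullet> y)\<^sup>2)"
      using int by (simp add: inner_matrix_vector_outer inner_commute flip: integral_inner_right)
    then show ?thesis
      by simp
  qed
  ultimately show ?thesis
    by (simp add: pos_semidef_def)
qed

text \<open>
  A point outside the closed set \<open>C\<close> has the null set \<open>- C\<close> as a neighbourhood, so it is not in the support.
\<close>

lemma measure_support_distr_subset:
  fixes X :: "'a \<Rightarrow> 'b::topological_space"
  assumes "random_variable borel X" and "closed C" and "prob {\<omega> \<in> space M. X \<omega> \<in> C} = 1"
  shows "measure_support (distr M borel X) \<subseteq> C"
proof
  fix z
  assume z: "z \<in> measure_support (distr M borel X)"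
  show "z \<in> C"
  proof (rule ccontr)
    assume "z \<notin> C"
    then have "0 < emeasure (distr M borel X) (- C)"
      using z assms(2) by (auto simp: measure_support_def)
    moreover have "AE \<omega> in M. X \<omega> \<in> C"
    proof -
      have "X -` C \<inter> space M \<in> events"
        using assms by (intro measurable_sets[of X M borel]) auto
      moreover have "X -` C \<inter> space M = {\<omega> \<in> space M. X \<omega> \<in> C}"
        by auto
      ultimately show ?thesis
        using assms(3) prob_Collect_eq_1 by simp
    qed
    then have "emeasure (distr M borel X) (- C) = 0"
      using assms emeasure_eq_0_AE[of "\<lambda>\<omega>. X \<omega> \<in> - C" M]
      by (subst emeasure_distr) (auto simp: vimage_def Int_def conj_commute)
    ultimately show False
      by simp
  qed
qed

section \<open>Expected cost and state moments under an affine policy\<close>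

text \<open>
  Here \<open>F\<close> is the feedback signal and \<open>W\<close> the disturbance. All terms that are linear in \<open>(F, W)\<close> average
  to zero. Of the rest, the terms in \<open>F\<close> alone pair with \<open>\<Omega>\<^sub>1\<close>, the mixed term with \<open>\<Omega>\<^sub>2\<close>, and
  the term in \<open>W\<close> alone involves neither \<open>K\<close> nor \<open>v\<close>.
\<close>

lemma expected_quadratic_cost:
  fixes F :: "'a \<Rightarrow> real^'f" and W :: "'a \<Rightarrow> real^'w" and Q :: "real^'x^'x" and R :: "real^'u^'u"
    and B :: "real^'u^'x" and D :: "real^'w^'x" and K :: "real^'f^'u"
  assumes F: "square_integrable M F" "expectation F = 0"
    and W: "square_integrable M W" "expectation W = 0"
    and sym: "transpose Q = Q" "transpose R = R"
  defines "\<Omega>\<^sub>1 \<equiv> expectation (\<lambda>\<omega>. outer (F \<omega>) (F \<omega>))"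
    and "\<Omega>\<^sub>2 \<equiv> expectation (\<lambda>\<omega>. outer (F \<omega>) (W \<omega>))"
    and "S\<^sub>1 \<equiv> transpose B ** Q ** B + R"
    and "S\<^sub>2 \<equiv> 2 *\<^sub>R (transpose D ** Q ** B)"
  shows "expectation (\<lambda>\<omega>. wnorm2 Q (d + B *v (K *v F \<omega> + v) + D *v W \<omega>) + wnorm2 R (K *v F \<omega> + v))
    = (2 *\<^sub>R (d v* (Q ** B))) \<bullet> v + wnorm2 S\<^sub>1 v + (transpose S\<^sub>2 ** transpose \<Omega>\<^sub>2) \<bullet> K
      + wnorm2 (kron \<Omega>\<^sub>1 S\<^sub>1) (vectorize K) + (wnorm2 Q d + expectation (\<lambda>\<omega>. wnorm2 Q (D *v W \<omega>)))"
proof -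
  define e where "e = d + B *v v"
  define Y where "Y \<omega> = (B ** K) *v F \<omega> + D *v W \<omega>" for \<omega>
  define c where "c = wnorm2 Q e + wnorm2 R v"
  define X where "X = transpose (B ** K) ** Q ** D"
  note FF = expectation_bilinear[OF F(1) F(1)] and FW = expectation_bilinear[OF F(1) W(1)]
  have Y: "integrable M Y" "expectation Y = 0"
    using F W unfolding Y_def
    by (simp_all add: expectation_matrix_vector square_integrable_integrable)
  have KF: "integrable M (\<lambda>\<omega>. K *v F \<omega>)" "expectation (\<lambda>\<omega>. K *v F \<omega>) = 0"
    using F by (simp_all add: expectation_matrix_vector square_integrable_integrable)
  have quad: "wnorm2 Q ((B ** K) *v F \<omega>) + wnorm2 R (K *v F \<omega>)
      = F \<omega> \<bullet> ((transpose K ** S\<^sub>1 ** K) *v F \<omega>)" for \<omega>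
    by (simp add: wnorm2_def inner_matrix_vector_congruence S\<^sub>1_def matrix_transpose_mul
        matrix_mul_assoc matrix_add_ldistrib matrix_add_rdistrib matrix_vector_mult_add_rdistrib
        inner_simps)
  have "wnorm2 Q (d + B *v (K *v F \<omega> + v) + D *v W \<omega>) + wnorm2 R (K *v F \<omega> + v)
      = c + 2 * (e \<bullet> (Q *v Y \<omega>)) + 2 * (v \<bullet> (R *v (K *v F \<omega>)))
        + F \<omega> \<bullet> ((transpose K ** S\<^sub>1 ** K) *v F \<omega>) + 2 * (F \<omega> \<bullet> (X *v W \<omega>))
        + wnorm2 Q (D *v W \<omega>)" for \<omega>
  proof -
    have x: "d + B *v (K *v F \<omega> + v) + D *v W \<omega> = e + Y \<omega>"
      by (simp add: e_def Y_def matrix_vector_right_distrib matrix_vector_mul_assoc)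
    have "wnorm2 Q (Y \<omega>) = wnorm2 Q ((B ** K) *v F \<omega>)
        + 2 * (F \<omega> \<bullet> (X *v W \<omega>)) + wnorm2 Q (D *v W \<omega>)"
      by (simp add: Y_def wnorm2_add[OF sym(1)] inner_matrix_vector_congruence X_def)
    moreover have "wnorm2 R (K *v F \<omega> + v) = wnorm2 R v + 2 * (v \<bullet> (R *v (K *v F \<omega>))) + wnorm2 R (K *v F \<omega>)"
      using wnorm2_add[OF sym(2), of v "K *v F \<omega>"] by (simp add: add.commute)
    ultimately show ?thesis
      using quad[of \<omega>] unfolding x wnorm2_add[OF sym(1), of e] c_def by simp
  qed
  moreover have "integrable M (\<lambda>\<omega>. wnorm2 Q (D *v W \<omega>))"
    unfolding wnorm2_def inner_matrix_vector_congruence by (rule expectation_bilinear[OF W(1) W(1)])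
  ultimately have "expectation (\<lambda>\<omega>. wnorm2 Q (d + B *v (K *v F \<omega> + v) + D *v W \<omega>)
        + wnorm2 R (K *v F \<omega> + v))
      = c + (transpose K ** S\<^sub>1 ** K) \<bullet> \<Omega>\<^sub>1 + 2 * (X \<bullet> \<Omega>\<^sub>2)
        + expectation (\<lambda>\<omega>. wnorm2 Q (D *v W \<omega>))"
    by (simp add: FF FW expectation_linear_form_zero[OF Y] expectation_linear_form_zero[OF KF]
        \<Omega>\<^sub>1_def \<Omega>\<^sub>2_def prob_space)
  moreover have "2 * (X \<bullet> \<Omega>\<^sub>2) = (transpose S\<^sub>2 ** transpose \<Omega>\<^sub>2) \<bullet> K"
  proof -
    have "(transpose B ** Q ** D ** transpose \<Omega>\<^sub>2) \<bullet> K = (transpose B ** Q ** D) \<bullet> (K ** \<Omega>\<^sub>2)"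
      by (simp add: inner_matrix_mult_right[of _ "transpose \<Omega>\<^sub>2"])
    also have "\<dots> = (transpose K ** (transpose B ** Q ** D)) \<bullet> \<Omega>\<^sub>2"
      by (simp add: inner_matrix_mult_left[of "transpose K"])
    finally show ?thesis
      using sym by (simp add: X_def S\<^sub>2_def matrix_transpose_mul transpose_scalar matrix_mul_assoc
          flip: scalar_matrix_assoc)
  qed
  moreover have "c = wnorm2 Q d + (2 *\<^sub>R (d v* (Q ** B))) \<bullet> v + wnorm2 S\<^sub>1 v"
  proof -
    have "d \<bullet> (Q *v (B *v v)) = (d v* (Q ** B)) \<bullet> v"
      by (simp add: dot_lmul_matrix matrix_vector_mul_assoc)
    moreover have "wnorm2 Q (B *v v) + wnorm2 R v = wnorm2 S\<^sub>1 v"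
      by (simp only: wnorm2_def inner_matrix_vector_congruence S\<^sub>1_def
          matrix_vector_mult_add_rdistrib inner_add_right)
    ultimately show ?thesis
      by (simp add: c_def e_def wnorm2_add[OF sym(1)])
  qed
  ultimately show ?thesis
    by (simp add: wnorm2_kron_vectorize)
qed

text \<open>
  The deviation of the state from its mean in the direction \<open>h\<close> is \<open>y \<bullet> F + g \<bullet> W\<close> with \<open>y = h\<^sup>T B K\<close> and
  \<open>g = h\<^sup>T D\<close>. Its second moment is quadratic in \<open>y\<close> with the positive semidefinite matrix \<open>\<Omega>\<^sub>1\<close>, and
  \<open>y\<close> is linear in \<open>K\<close>; this makes a bound on the variance a convex quadratic constraint on \<open>K\<close>.
\<close>

lemma policy_state_moments:
  fixes F :: "'a \<Rightarrow> real^'f" and W :: "'a \<Rightarrow> real^'w"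
    and B :: "real^'u^'x" and D :: "real^'w^'x" and K :: "real^'f^'u"
    and d h :: "real^'x" and v :: "real^'u"
  assumes F: "square_integrable M F" "expectation F = 0"
    and W: "square_integrable M W" "expectation W = 0"
  defines "\<Omega>\<^sub>1 \<equiv> expectation (\<lambda>\<omega>. outer (F \<omega>) (F \<omega>))"
    and "\<Omega>\<^sub>2 \<equiv> expectation (\<lambda>\<omega>. outer (F \<omega>) (W \<omega>))"
    and "X \<equiv> \<lambda>\<omega>. d + B *v (K *v F \<omega> + v) + D *v W \<omega>"
  shows "expectation X = d + B *v v"
    and "h \<bullet> (covariance M X *v h) =
      wnorm2 \<Omega>\<^sub>1 (h v* (B ** K)) + (2 *\<^sub>R (h v* (D ** transpose \<Omega>\<^sub>2))) \<bullet> (h v* (B ** K))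
      + h \<bullet> ((D ** covariance M W ** transpose D) *v h)"
proof -
  define Y where "Y \<omega> = (B ** K) *v F \<omega> + D *v W \<omega>" for \<omega>
  have X: "X = (\<lambda>\<omega>. (d + B *v v) + Y \<omega>)"
    by (simp add: X_def Y_def fun_eq_iff matrix_vector_right_distrib matrix_vector_mul_assoc)
  have Y: "square_integrable M Y" "expectation Y = 0"
    using F W unfolding Y_def
    by (simp_all add: expectation_matrix_vector square_integrable_integrable
        square_integrable_add square_integrable_matrix)
  show "expectation X = d + B *v v"
    unfolding X by (rule covariance_shift[OF Y])
  define y where "y = h v* (B ** K)"
  define g where "g = h v* D"
  have sq: "Y \<omega> \<bullet> (outer h h *v Y \<omega>)
      = F \<omega> \<bullet> (outer y y *v F \<omega>) + 2 * (F \<omega> \<bullet> (outer y g *v W \<omega>)) + W \<omega> \<bullet> (outer g g *v W \<omega>)" for \<omega>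
  proof -
    have "h \<bullet> Y \<omega> = y \<bullet> F \<omega> + g \<bullet> W \<omega>"
      by (simp add: Y_def y_def g_def inner_simps dot_lmul_matrix)
    then show ?thesis
      by (simp add: outer_mult_vector inner_commute algebra_simps)
  qed
  have "h \<bullet> (covariance M X *v h) = expectation (\<lambda>\<omega>. Y \<omega> \<bullet> (outer h h *v Y \<omega>))"
    unfolding X covariance_shift(2)[OF Y]
    by (subst expectation_bilinear(2)[OF Y(1) Y(1)]) (simp add: inner_matrix_vector_outer inner_commute)
  also have "\<dots> = outer y y \<bullet> \<Omega>\<^sub>1 + 2 * (outer y g \<bullet> \<Omega>\<^sub>2) + outer g g \<bullet> covariance M W"
    unfolding sq \<Omega>\<^sub>1_def \<Omega>\<^sub>2_def
    using covariance_shift(2)[OF W, of 0]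
      expectation_bilinear[OF F(1) F(1)] expectation_bilinear[OF F(1) W(1)]
      expectation_bilinear[OF W(1) W(1)] by simp
  also have "outer y y \<bullet> \<Omega>\<^sub>1 = wnorm2 \<Omega>\<^sub>1 y"
    by (simp add: wnorm2_def inner_matrix_vector_outer inner_commute)
  also have "2 * (outer y g \<bullet> \<Omega>\<^sub>2) = (2 *\<^sub>R (h v* (D ** transpose \<Omega>\<^sub>2))) \<bullet> y"
    by (simp add: inner_commute g_def inner_matrix_vector_outer[symmetric]
        flip: vector_matrix_mul_assoc)
  also have "outer g g \<bullet> covariance M W = h \<bullet> ((D ** covariance M W ** transpose D) *v h)"
    by (simp add: g_def inner_commute[of "outer _ _"] inner_matrix_vector_outer[symmetric]
        dot_lmul_matrix flip: matrix_vector_mul_assoc)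
  finally show "h \<bullet> (covariance M X *v h) =
      wnorm2 \<Omega>\<^sub>1 (h v* (B ** K)) + (2 *\<^sub>R (h v* (D ** transpose \<Omega>\<^sub>2))) \<bullet> (h v* (B ** K))
      + h \<bullet> ((D ** covariance M W ** transpose D) *v h)"
    unfolding y_def .
qed

end

section \<open>The explicit problem\<close>

text \<open>
  The set is the epigraph of the quadratic cost over the feasible set, with free parameters for the data
  of the control problem. Entry by entry, each constraint bounds a linear form or the sum of a positive
  semidefinite quadratic form and a linear form.
\<close>

lemma robust_program_socp_representable:
  fixes S :: "real^('t::{finite,linorder} \<times> 'u::finite)^('t \<times> 'u)"
    and \<Lambda> :: "real^(('t \<times> 'x::finite) \<times> ('t \<times> 'u))^(('t \<times> 'x) \<times> ('t \<times> 'u))"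
    and \<Omega> :: "real^('t \<times> 'x)^('t \<times> 'x)"
    and H\<^sub>u :: "real^('t \<times> 'u)^'s" and k\<^sub>u :: "real^'s"
    and H\<^sub>w :: "real^('t \<times> 'x)^'a" and k\<^sub>w :: "real^'a"
    and B :: "real^('t \<times> 'u)^'y" and h :: "'t \<Rightarrow> 'r::finite \<Rightarrow> real^'y"
  assumes "pos_semidef S" "pos_semidef \<Lambda>" "pos_semidef \<Omega>"
  shows "socp_representable {((M, v, Z, \<epsilon> :: real^(('t \<times> 'r) + ('t \<times> 'r))), \<tau>).
      (M, v, Z, \<epsilon>) \<in> {(M, v, Z, \<epsilon>).
         strictly_block_lower M \<and>
         H\<^sub>u *v v + transpose Z *v k\<^sub>w \<le> k\<^sub>u \<and>
         transpose Z ** H\<^sub>w = H\<^sub>u ** M \<and>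
         0 \<le> Z \<and>
         (\<forall>i j. m i j + h i j \<bullet> (B *v v) \<le> l i j + \<epsilon> $ Inl (i, j) \<and>
            wnorm2 \<Omega> (h i j v* (B ** M)) + q i j \<bullet> (h i j v* (B ** M)) + c i j \<le> \<epsilon> $ Inr (i, j) \<and>
            0 \<le> \<epsilon> $ Inl (i, j) \<and> 0 \<le> \<epsilon> $ Inr (i, j))} \<and>
      wnorm2 S v + wnorm2 \<Lambda> (vectorize M) \<le> \<tau>}"
    (is "socp_representable ?P")
proof -
  let ?M = "\<lambda>z. fst (fst z)" and ?v = "\<lambda>z. fst (snd (fst z))"
    and ?Z = "\<lambda>z. fst (snd (snd (fst z)))" and ?\<epsilon> = "\<lambda>z. snd (snd (snd (fst z)))"
  have Hu: "H\<^sub>u *v v + transpose Z *v k\<^sub>w \<le> k\<^sub>u \<longleftrightarrow> (\<forall>s. H\<^sub>u $ s \<bullet> v + k\<^sub>w \<bullet> transpose Z $ s \<le> k\<^sub>u $ s)" for v Z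
    by (simp add: less_eq_vec_def matrix_vector_mul_component inner_commute del: transpose_matrix_vector)
  have Hw: "transpose Z ** H\<^sub>w = H\<^sub>u ** M \<longleftrightarrow> (\<forall>s n. (transpose Z ** H\<^sub>w - H\<^sub>u ** M) $ s $ n = 0)" for M Z
    by (simp add: vec_eq_iff)
  have Z: "0 \<le> Z \<longleftrightarrow> (\<forall>a s. - Z $ a $ s \<le> 0)" for Z :: "real^'s^'a"
    by (simp add: less_eq_vec_def)
  \<comment> \<open>one scalar constraint per entry, with the constants on the right-hand side\<close>
  have eq: "?P = {z.
      (\<forall>p i q j. p \<le> q \<longrightarrow> ?M z $ (p, i) $ (q, j) = 0) \<and>
      (\<forall>s. H\<^sub>u $ s \<bullet> ?v z + k\<^sub>w \<bullet> transpose (?Z z) $ s \<le> k\<^sub>u $ s) \<and>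
      (\<forall>s n. (transpose (?Z z) ** H\<^sub>w - H\<^sub>u ** ?M z) $ s $ n = 0) \<and>
      (\<forall>a s. - ?Z z $ a $ s \<le> 0) \<and>
      (\<forall>i j. h i j \<bullet> (B *v ?v z) - ?\<epsilon> z $ Inl (i, j) \<le> l i j - m i j \<and>
         wnorm2 \<Omega> (h i j v* (B ** ?M z)) + (q i j \<bullet> (h i j v* (B ** ?M z)) - ?\<epsilon> z $ Inr (i, j)) \<le> - c i j \<and>
         - ?\<epsilon> z $ Inl (i, j) \<le> 0 \<and> - ?\<epsilon> z $ Inr (i, j) \<le> 0) \<and>
      (wnorm2 S (?v z) + wnorm2 \<Lambda> (vectorize (?M z))) + - snd z \<le> 0}"
    (is "_ = ?R")
  proof (rule set_eqI)
    fix z :: "((real^('t \<times> 'x)^('t \<times> 'u)) \<times> (real^('t \<times> 'u)) \<times> (real^'s^'a) \<times> (real^(('t \<times> 'r) + ('t \<times> 'r)))) \<times> real"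
    obtain M v Z \<epsilon> \<tau> where z: "z = ((M, v, Z, \<epsilon>), \<tau>)"
      by (metis surj_pair)
    show "z \<in> ?P \<longleftrightarrow> z \<in> ?R"
      unfolding z mem_Collect_eq prod.case fst_conv snd_conv strictly_block_lower_def Hu Hw Z conj_assoc
      by (intro arg_cong2[where f = "(\<and>)"] iff_allI refl; rule iffI; linarith)
  qed
  note simps = matrix_add_ldistrib matrix_add_rdistrib vector_matrix_mult_add_rdistrib
    vector_scaleR_matrix_ac matrix_vector_right_distrib matrix_vector_mult_scaleR inner_simps
    matrix_scalar_ac scalar_matrix_assoc[symmetric] transpose_scalar algebra_simps transpose_add
  have B: "linear (\<lambda>z. h i j v* (B ** ?M z))" for i j
    by (simp add: linear_iff simps)
  show ?thesis
    unfolding eq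
    by (intro socp_representable_conj socp_representable_all socp_representable_imp
        socp_representable_linear_le socp_representable_linear_eq socp_representable_quadratic_le
        sum_of_squares_add sum_of_squares_linear[OF _ pos_semidef_sum_of_squares] assms)
      (auto simp: linear_iff simps vectorize_def vec_eq_iff)
qed

theorem theorem1:
  fixes A :: "real^'x^'x" and B :: "real^'u^'x" and G :: "real^'w^'x"
    and Q :: "real^'x^'x" and R :: "real^'u^'u"
    and H\<^sub>u :: "real^'u^'s" and k\<^sub>u :: "real^'s"
    and H\<^sub>x :: "real^'x^'r" and k\<^sub>x :: "real^'r"
    and H\<^sub>w :: "real^('t::{finite,linorder} \<times> 'x)^'a" and k\<^sub>w :: "real^'a"
    and P :: "'o measure" and w :: "'t \<Rightarrow> 'o \<Rightarrow> real^'w"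
    and p\<^sub>w :: "real^'w \<Rightarrow> ennreal" and \<Delta>\<^sub>w :: "(real^'w) set" and \<Sigma>\<^sub>w :: "real^'w^'w"
    and \<phi> :: "'t \<Rightarrow> 'x \<Rightarrow> real \<Rightarrow> real" and \<phi>\<^sub>m\<^sub>a\<^sub>x :: real
    and \<W> :: "(real^('t \<times> 'x)) set"
    and x :: "real^'x" and \<rho> \<beta> :: real and \<delta> \<alpha> :: "real^'r"
  \<comment> \<open>standing assumptions\<close>
  assumes "schur_stable A"
    and "pos_semidef Q" and "pos_semidef R"
    and "prob_space P"
    and "prob_space.indep_vars P (\<lambda>_. borel) w UNIV"
    and "\<And>i. distributed P lborel (w i) p\<^sub>w"
    and "\<And>i. square_integrable P (w i)"
    and "\<And>i. integral\<^sup>L P (w i) = 0"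
    and "\<And>i. covariance P (w i) = \<Sigma>\<^sub>w"
    and "pos_def \<Sigma>\<^sub>w"
    and "\<Delta>\<^sub>w = {z. p\<^sub>w z \<noteq> 0}"
    and "compact {z. H\<^sub>u *v z \<le> k\<^sub>u}"
    and "0 \<in> interior {z. H\<^sub>u *v z \<le> k\<^sub>u}"
    and "0 \<le> \<beta>" and "\<beta> < 1"
  \<comment> \<open>stacked system data\<close>
    and "AA = prediction_A A"
    and "DD = (prediction_D A :: real^('t \<times> 'x)^('t option \<times> 'x))"
    and "BB = DD ** block_diag B"
    and "GG = (block_diag G :: real^('t \<times> 'w)^('t \<times> 'x))"
    and "QQ = (block_diag Q :: real^('t option \<times> 'x)^('t option \<times> 'x))"
    and "RR = (block_diag R :: real^('t \<times> 'u)^('t \<times> 'u))"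
    and "HH\<^sub>u = (block_diag H\<^sub>u :: real^('t \<times> 'u)^('t \<times> 's))"
    and "kk\<^sub>u = stack (\<lambda>_::'t. k\<^sub>u)"
    and "HH\<^sub>x = (\<lambda>i::'t. block_row (Some i) H\<^sub>x)"
    and "ww = (\<lambda>\<omega>. stack (\<lambda>i. w i \<omega>))"
  \<comment> \<open>saturated disturbances\<close>
    and "\<And>i l. \<phi> i l \<in> borel_measurable borel"
    and "\<And>i l b. \<bar>\<phi> i l b\<bar> \<le> \<phi>\<^sub>m\<^sub>a\<^sub>x"
    and "\<Phi> = (\<lambda>\<omega>. saturate \<phi> (GG *v ww \<omega>))"
    and "\<W> = {\<eta>. H\<^sub>w *v \<eta> \<le> k\<^sub>w}"
    and "\<And>f. (\<forall>i. f i \<in> \<Delta>\<^sub>w) \<Longrightarrow> saturate \<phi> (GG *v stack f) \<in> \<W>"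
    and "integral\<^sup>L P \<Phi> = 0"
  \<comment> \<open>observed state and design parameters\<close>
    and "0 \<le> \<rho>"
    and "\<And>j. 0 \<le> \<delta> $ j"
    and "\<And>j. 0 \<le> \<alpha> $ j" and "\<And>j. \<alpha> $ j < 1"
    and "(\<Sum>j\<in>UNIV. \<alpha> $ j) = \<beta>"
  \<comment> \<open>inputs, predicted states and expected cost under a policy\<close>
    and "uu = (\<lambda>(M :: real^('t \<times> 'x)^('t \<times> 'u)) (v :: real^('t \<times> 'u)) \<omega>. M *v \<Phi> \<omega> + v)"
    and "xx = (\<lambda>M v \<omega>. AA *v x + BB *v uu M v \<omega> + (DD ** GG) *v ww \<omega>)"
    and "V = (\<lambda>M v. integral\<^sup>L P (\<lambda>\<omega>. wnorm2 QQ (xx M v \<omega>) + wnorm2 RR (uu M v \<omega>)))"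
  \<comment> \<open>the slack vector has the entries \<open>\<epsilon>\<^sup>m\<^sub>i\<^sub>j = \<epsilon> $ Inl (i, j)\<close> and \<open>\<epsilon>\<^sup>v\<^sub>i\<^sub>j = \<epsilon> $ Inr (i, j)\<close>\<close>
    and "soft = (\<lambda>M v (\<epsilon> :: real^(('t \<times> 'r) + ('t \<times> 'r))).
           strictly_block_lower M \<and> 0 \<le> \<epsilon> \<and>
           (\<forall>i j. HH\<^sub>x i $ j \<bullet> integral\<^sup>L P (xx M v) \<le> k\<^sub>x $ j - \<delta> $ j + \<epsilon> $ Inl (i, j) \<and>
                  HH\<^sub>x i $ j \<bullet> (covariance P (xx M v) *v HH\<^sub>x i $ j)
                    \<le> \<alpha> $ j * (\<delta> $ j)\<^sup>2 / (1 - \<alpha> $ j) + \<epsilon> $ Inr (i, j)))"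
  \<comment> \<open>the softened problem, and its variant with the input constraint imposed on all of \<open>\<W>\<close>\<close>
    and "SP_objective = (\<lambda>(M, v, \<epsilon>). V M v + \<rho> * (\<Sum>k\<in>UNIV. \<bar>\<epsilon> $ k\<bar>))"
    and "SP_feasible = {(M, v, \<epsilon>). soft M v \<epsilon> \<and>
           measure P {\<omega> \<in> space P. HH\<^sub>u *v uu M v \<omega> \<le> kk\<^sub>u} = 1}"
    and "SP_robust_feasible = {(M, v, \<epsilon>). soft M v \<epsilon> \<and>
           (\<forall>\<eta>\<in>\<W>. HH\<^sub>u *v (M *v \<eta> + v) \<le> kk\<^sub>u)}"
  \<comment> \<open>the coefficients\<close>
    and "b = 2 *\<^sub>R (x v* (transpose AA ** QQ ** BB))"
    and "S\<^sub>1 = transpose BB ** QQ ** BB + RR"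
    and "S\<^sub>2 = 2 *\<^sub>R (transpose GG ** transpose DD ** QQ ** BB)"
    and "\<Omega>\<^sub>1 = integral\<^sup>L P (\<lambda>\<omega>. outer (\<Phi> \<omega>) (\<Phi> \<omega>))"
    and "\<Omega>\<^sub>2 = integral\<^sup>L P (\<lambda>\<omega>. outer (\<Phi> \<omega>) (ww \<omega>))"
    and "\<Lambda> = kron \<Omega>\<^sub>1 (transpose S\<^sub>1)"
    and "\<nu> = vectorize (transpose S\<^sub>2 ** transpose \<Omega>\<^sub>2)"
    and "q = (\<lambda>i j. 2 *\<^sub>R (HH\<^sub>x i $ j v* (DD ** GG ** transpose \<Omega>\<^sub>2)))"
    and "c = (\<lambda>i j. HH\<^sub>x i $ j \<bullet>
           ((DD ** GG ** covariance P ww ** transpose GG ** transpose DD) *v HH\<^sub>x i $ j)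
           - \<alpha> $ j * (\<delta> $ j)\<^sup>2 * inverse (1 - \<alpha> $ j))"
    and "y = (\<lambda>M i j. HH\<^sub>x i $ j v* (BB ** M))"
  \<comment> \<open>the explicit problem\<close>
    and "linear_part = (\<lambda>(M, v, Z :: real^('t \<times> 's)^'a, \<epsilon>).
           b \<bullet> v + \<nu> \<bullet> vectorize M + \<rho> * (1 \<bullet> \<epsilon>))"
    and "quadratic_part = (\<lambda>(M, v, Z :: real^('t \<times> 's)^'a, \<epsilon> :: real^(('t \<times> 'r) + ('t \<times> 'r))).
           wnorm2 S\<^sub>1 v + wnorm2 \<Lambda> (vectorize M))"
    and "feasible = {(M, v, Z, \<epsilon>).
           strictly_block_lower M \<and>
           HH\<^sub>u *v v + transpose Z *v k\<^sub>w \<le> kk\<^sub>u \<and>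
           transpose Z ** H\<^sub>w = HH\<^sub>u ** M \<and>
           0 \<le> Z \<and>
           (\<forall>i j. HH\<^sub>x i $ j \<bullet> (AA *v x) + HH\<^sub>x i $ j \<bullet> (BB *v v)
                    \<le> k\<^sub>x $ j - \<delta> $ j + \<epsilon> $ Inl (i, j) \<and>
                  wnorm2 \<Omega>\<^sub>1 (y M i j) + q i j \<bullet> y M i j + c i j \<le> \<epsilon> $ Inr (i, j) \<and>
                  0 \<le> \<epsilon> $ Inl (i, j) \<and> 0 \<le> \<epsilon> $ Inr (i, j))}"
  \<comment> \<open>equality of the objectives up to a constant, comparison of the feasible sets, convexity, cone program\<close>
  shows "(\<exists>\<kappa>. \<forall>M v Z \<epsilon>. 0 \<le> \<epsilon> \<longrightarrow>
            SP_objective (M, v, \<epsilon>)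
              = linear_part (M, v, Z, \<epsilon>) + quadratic_part (M, v, Z, \<epsilon>) + \<kappa>) \<and>
         {(M, v, \<epsilon>). \<exists>Z. (M, v, Z, \<epsilon>) \<in> feasible} = SP_robust_feasible \<and>
         SP_robust_feasible \<subseteq> SP_feasible \<and>
         (\<W> = convex hull measure_support (distr P borel \<Phi>) \<longrightarrow>
            {(M, v, \<epsilon>). \<exists>Z. (M, v, Z, \<epsilon>) \<in> feasible} = SP_feasible) \<and>
         convex feasible \<and>
         convex_on feasible (\<lambda>z. linear_part z + quadratic_part z) \<and>
         is_epigraph_socp linear_part quadratic_part feasible"
proof -
  interpret prob_space P
    by fact
  note QQ = assms(20) and RR = assms(21) and ww = assms(25)
  note \<Phi> = assms(28) and \<W> = assms(29)
  note uu = assms(37) and xx = assms(38) and V = assms(39) and soft = assms(40)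
    and SP_objective = assms(41) and SP_feasible = assms(42) and SP_robust_feasible = assms(43)
  note b = assms(44) and S\<^sub>1 = assms(45) and S\<^sub>2 = assms(46) and \<Omega>\<^sub>1 = assms(47) and \<Omega>\<^sub>2 = assms(48)
    and \<Lambda> = assms(49) and \<nu> = assms(50) and q = assms(51) and c = assms(52) and y = assms(53)
    and linear_part = assms(54) and quadratic_part = assms(55) and feasible = assms(56)

  have ww_int: "square_integrable P ww"
    unfolding ww using assms(7) by (rule square_integrable_stack)
  have ww_mean: "integral\<^sup>L P ww = 0"
    unfolding ww using assms(7,8) by (rule expectation_stack_zero)
  have \<Phi>_meas: "\<Phi> \<in> borel_measurable P"
    unfolding \<Phi> using assms(26) square_integrable_matrix[OF ww_int, of GG]
    by (intro saturate_borel_measurable) (simp_all add: square_integrable_def)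
  have \<Phi>_int: "square_integrable P \<Phi>"
    using \<Phi>_meas by (rule square_integrable_bounded[where r = \<phi>\<^sub>m\<^sub>a\<^sub>x]) (simp add: \<Phi> saturate_def assms(27))
  note \<Phi>_mean = assms(31)

  have \<Phi>_in_\<W>: "AE \<omega> in P. \<Phi> \<omega> \<in> \<W>"
  proof -
    have "AE \<omega> in P. \<forall>i. p\<^sub>w (w i \<omega>) \<noteq> 0"
      using distributed_AE_density_nonzero[OF assms(6)] by (simp add: AE_all_countable)
    then show ?thesis
      unfolding \<Phi> ww by (rule eventually_mono) (use assms(11,30) in auto)
  qed
  then obtain \<eta>\<^sub>0 where \<eta>\<^sub>0: "H\<^sub>w *v \<eta>\<^sub>0 \<le> k\<^sub>w"
    using eventually_happens'[OF ae_filter_bot] unfolding \<W> by blast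

  have psd: "pos_semidef QQ" "pos_semidef RR"
    unfolding QQ RR using assms(2,3) by (simp_all add: pos_semidef_block_diag)
  then have sym: "transpose QQ = QQ" "transpose RR = RR"
    by (simp_all add: pos_semidef_def)
  have psd_S\<^sub>1: "pos_semidef S\<^sub>1"
    unfolding S\<^sub>1 using psd by (intro pos_semidef_add pos_semidef_congruence)
  then have sym_S\<^sub>1: "transpose S\<^sub>1 = S\<^sub>1"
    by (simp add: pos_semidef_def)
  have psd_\<Omega>\<^sub>1: "pos_semidef \<Omega>\<^sub>1"
    unfolding \<Omega>\<^sub>1 using \<Phi>_int by (rule second_moment_pos_semidef)
  have psd_\<Lambda>: "pos_semidef \<Lambda>"
    unfolding \<Lambda> sym_S\<^sub>1 using psd_\<Omega>\<^sub>1 psd_S\<^sub>1 by (rule pos_semidef_kron)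

  \<comment> \<open>the cost of the unforced mean trajectory, and the cost of the open-loop disturbance response\<close>
  define \<kappa> where "\<kappa> = wnorm2 QQ (AA *v x) + (\<integral>\<omega>. wnorm2 QQ ((DD ** GG) *v ww \<omega>) \<partial>P)"
  have cost: "SP_objective (M, v, \<epsilon>) = linear_part (M, v, Z, \<epsilon>) + quadratic_part (M, v, Z, \<epsilon>) + \<kappa>"
    if "0 \<le> \<epsilon>" for M v Z \<epsilon>
  proof -
    have "b = 2 *\<^sub>R ((AA *v x) v* (QQ ** BB))"
      by (simp add: b flip: vector_matrix_mul_assoc)
    moreover have "S\<^sub>2 = 2 *\<^sub>R (transpose (DD ** GG) ** QQ ** BB)"
      by (simp add: S\<^sub>2 matrix_transpose_mul)
    ultimately have "V M v = b \<bullet> v + wnorm2 S\<^sub>1 v + \<nu> \<bullet> vectorize M + wnorm2 \<Lambda> (vectorize M) + \<kappa>"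
      unfolding V xx uu \<kappa>_def \<nu> inner_vectorize \<Lambda> sym_S\<^sub>1
      using expected_quadratic_cost[OF \<Phi>_int \<Phi>_mean ww_int ww_mean sym,
          where B = BB and D = "DD ** GG" and K = M and d = "AA *v x" and v = v]
      by (simp add: S\<^sub>1 \<Omega>\<^sub>1 \<Omega>\<^sub>2)
    moreover have "(\<Sum>k\<in>UNIV. \<bar>\<epsilon> $ k\<bar>) = 1 \<bullet> \<epsilon>"
      using that by (simp add: inner_vec_def less_eq_vec_def)
    ultimately show ?thesis
      by (simp add: SP_objective linear_part quadratic_part)
  qed

  have soft_iff: "soft M v \<epsilon> \<longleftrightarrow> strictly_block_lower M \<and>
      (\<forall>i j. HH\<^sub>x i $ j \<bullet> (AA *v x) + HH\<^sub>x i $ j \<bullet> (BB *v v) \<le> k\<^sub>x $ j - \<delta> $ j + \<epsilon> $ Inl (i, j) \<and>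
        wnorm2 \<Omega>\<^sub>1 (y M i j) + q i j \<bullet> y M i j + c i j \<le> \<epsilon> $ Inr (i, j) \<and>
        0 \<le> \<epsilon> $ Inl (i, j) \<and> 0 \<le> \<epsilon> $ Inr (i, j))" for M v \<epsilon>
  proof -
    note moments = policy_state_moments[OF \<Phi>_int \<Phi>_mean ww_int ww_mean,
        where B = BB and D = "DD ** GG" and K = M and d = "AA *v x" and v = v]
    have mean: "HH\<^sub>x i $ j \<bullet> integral\<^sup>L P (xx M v) = HH\<^sub>x i $ j \<bullet> (AA *v x) + HH\<^sub>x i $ j \<bullet> (BB *v v)" for i j
      using moments(1) by (simp add: xx uu inner_simps)
    have var: "HH\<^sub>x i $ j \<bullet> (covariance P (xx M v) *v HH\<^sub>x i $ j)
        = wnorm2 \<Omega>\<^sub>1 (y M i j) + q i j \<bullet> y M i j + c i j + \<alpha> $ j * (\<delta> $ j)\<^sup>2 / (1 - \<alpha> $ j)" for i j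
      unfolding xx uu moments(2)
      by (simp add: y q c \<Omega>\<^sub>1 \<Omega>\<^sub>2 matrix_transpose_mul matrix_mul_assoc divide_inverse)
    have "HH\<^sub>x i $ j \<bullet> (covariance P (xx M v) *v HH\<^sub>x i $ j) \<le> \<alpha> $ j * (\<delta> $ j)\<^sup>2 / (1 - \<alpha> $ j) + \<epsilon> $ Inr (i, j)
        \<longleftrightarrow> wnorm2 \<Omega>\<^sub>1 (y M i j) + q i j \<bullet> y M i j + c i j \<le> \<epsilon> $ Inr (i, j)" for i j
      unfolding var by linarith
    moreover have "0 \<le> \<epsilon> \<longleftrightarrow> (\<forall>i j. 0 \<le> \<epsilon> $ Inl (i, j) \<and> 0 \<le> \<epsilon> $ Inr (i, j))"
      by (auto simp: less_eq_vec_def split_sum_all)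
    ultimately show ?thesis
      unfolding soft mean by metis
  qed

  have projection: "{(M, v, \<epsilon>). \<exists>Z. (M, v, Z, \<epsilon>) \<in> feasible} = SP_robust_feasible"
  proof -
    have "(M, v, Z, \<epsilon>) \<in> feasible \<longleftrightarrow> soft M v \<epsilon> \<and> HH\<^sub>u *v v + transpose Z *v k\<^sub>w \<le> kk\<^sub>u \<and>
        transpose Z ** H\<^sub>w = HH\<^sub>u ** M \<and> 0 \<le> Z" for M v Z \<epsilon>
      unfolding soft_iff feasible by (simp only: mem_Collect_eq prod.case) blast
    then show ?thesis
      unfolding SP_robust_feasible
      using robust_linear_constraint_iff[OF \<eta>\<^sub>0, of HH\<^sub>u _ _ kk\<^sub>u] by (simp add: \<W>)
  qed

  have input_set: "closed {\<eta>. HH\<^sub>u *v (M *v \<eta> + v) \<le> kk\<^sub>u}" "convex {\<eta>. HH\<^sub>u *v (M *v \<eta> + v) \<le> kk\<^sub>u}"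
    for M :: "real^('t \<times> 'x)^('t \<times> 'u)" and v
  proof -
    have "{\<eta>. HH\<^sub>u *v (M *v \<eta> + v) \<le> kk\<^sub>u} = (\<Inter>s. {\<eta>. (HH\<^sub>u ** M) $ s \<bullet> \<eta> \<le> kk\<^sub>u $ s - (HH\<^sub>u *v v) $ s})"
      by (auto simp: less_eq_vec_def matrix_vector_right_distrib matrix_vector_mul_assoc
          matrix_vector_mul_component algebra_simps)
    then show "closed {\<eta>. HH\<^sub>u *v (M *v \<eta> + v) \<le> kk\<^sub>u}" "convex {\<eta>. HH\<^sub>u *v (M *v \<eta> + v) \<le> kk\<^sub>u}"
      by (auto intro!: closed_INT convex_INT closed_halfspace_le convex_halfspace_le)
  qed
  have input_event: "{\<omega> \<in> space P. HH\<^sub>u *v uu M v \<omega> \<le> kk\<^sub>u} \<in> events" for M v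
  proof -
    have "{\<omega> \<in> space P. HH\<^sub>u *v uu M v \<omega> \<le> kk\<^sub>u} = \<Phi> -` {\<eta>. HH\<^sub>u *v (M *v \<eta> + v) \<le> kk\<^sub>u} \<inter> space P"
      by (auto simp: uu)
    also have "\<dots> \<in> events"
      using \<Phi>_meas by (rule measurable_sets) (simp add: input_set(1))
    finally show ?thesis .
  qed

  have robust_imp: "SP_robust_feasible \<subseteq> SP_feasible"
  proof -
    have "prob {\<omega> \<in> space P. HH\<^sub>u *v uu M v \<omega> \<le> kk\<^sub>u} = 1"
      if "\<forall>\<eta>\<in>\<W>. HH\<^sub>u *v (M *v \<eta> + v) \<le> kk\<^sub>u" for M v
      unfolding prob_Collect_eq_1[OF input_event]
      using \<Phi>_in_\<W> by (rule eventually_mono) (use that in \<open>simp add: uu\<close>)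
    then show ?thesis
      unfolding SP_robust_feasible SP_feasible by auto
  qed

  \<comment> \<open>the admissible disturbances form a closed convex set, so they contain the hull of the support\<close>
  have tight: "SP_feasible \<subseteq> SP_robust_feasible" if "\<W> = convex hull measure_support (distr P borel \<Phi>)"
  proof -
    have "\<W> \<subseteq> {\<eta>. HH\<^sub>u *v (M *v \<eta> + v) \<le> kk\<^sub>u}"
      if "prob {\<omega> \<in> space P. HH\<^sub>u *v uu M v \<omega> \<le> kk\<^sub>u} = 1" for M v
      unfolding \<open>\<W> = convex hull _\<close> using that \<Phi>_meas input_set[of M v]
      by (intro hull_minimal measure_support_distr_subset) (simp_all add: uu)
    then show ?thesis
      unfolding SP_robust_feasible SP_feasible by auto
  qed

  have "linear linear_part"
    unfolding linear_part
    by (auto simp: linear_iff inner_simps linear_add[OF linear_vectorize] linear_scale[OF linear_vectorize]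
        algebra_simps)
  moreover have "socp_representable {(z, \<tau>). z \<in> feasible \<and> quadratic_part z \<le> \<tau>}"
    using robust_program_socp_representable[OF psd_S\<^sub>1 psd_\<Lambda> psd_\<Omega>\<^sub>1, where H\<^sub>u = HH\<^sub>u and k\<^sub>u = kk\<^sub>u
        and H\<^sub>w = H\<^sub>w and k\<^sub>w = k\<^sub>w and m = "\<lambda>i j. HH\<^sub>x i $ j \<bullet> (AA *v x)" and h = "\<lambda>i j. HH\<^sub>x i $ j"
        and B = BB and l = "\<lambda>i j. k\<^sub>x $ j - \<delta> $ j" and q = q and c = c]
    unfolding feasible quadratic_part y by (simp add: case_prod_beta')
  ultimately have "is_epigraph_socp linear_part quadratic_part feasible" "convex feasible"
    "convex_on feasible (\<lambda>z. linear_part z + quadratic_part z)"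
    by (rule socp_representable_epigraph)+
  then show ?thesis
    using cost projection robust_imp tight by blast
qed

end
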